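(* Let $\mathcal L$ be the even liaison class of a tetrahedral curve that is not arithmetically Cohen–Macaulay. Then $\mathcal L$ contains only finitely many tetrahedral curves whose ideals have a linear resolution.
   Context: Let $k$ be a field, $R=k[a,b,c,d]$. For nonnegative integers $a_1,\dots,a_6$, the tetrahedral curve $(a_1,\dots,a_6)$ is the curve in $\mathbb P^3$ with ideal $(a,b)^{a_1}\cap(a,c)^{a_2}\cap(a,d)^{a_3}\cap(b,c)^{a_4}\cap(b,d)^{a_5}\cap(c,d)^{a_6}$. The even liaison class of a curve is its equivalence class under linkage in an even number of steps by complete intersections. An ideal has a linear resolution if it is generated in one degree $d$ and the $i$-th module of its minimal free resolution is generated in degree $d+i$. *)

theory Defs
  imports Main "HOL-Library.Poly_Mapping"
begin

datatype var = Va | Vb | Vc | Vd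

type_synonym 'k mpoly4 = "(var \<Rightarrow>\<^sub>0 nat) \<Rightarrow>\<^sub>0 'k"

definition X :: "var \<Rightarrow> 'k::comm_ring_1 mpoly4" where
  "X v = Poly_Mapping.single (Poly_Mapping.single v 1) 1"

definition mon_deg :: "(var \<Rightarrow>\<^sub>0 nat) \<Rightarrow> nat" where
  "mon_deg m = (\<Sum>v\<in>Poly_Mapping.keys m. Poly_Mapping.lookup m v)"

text \<open>f is homogeneous of degree d (the zero polynomial is homogeneous of every degree).\<close>
definition homogeneous :: "nat \<Rightarrow> 'k::comm_ring_1 mpoly4 \<Rightarrow> bool" where
  "homogeneous d f \<longleftrightarrow> (\<forall>m\<in>Poly_Mapping.keys f. mon_deg m = d)"

definition is_ideal :: "'a::comm_ring_1 set \<Rightarrow> bool" where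
  "is_ideal I \<longleftrightarrow> 0 \<in> I \<and> (\<forall>x\<in>I. \<forall>y\<in>I. x + y \<in> I) \<and> (\<forall>r. \<forall>x\<in>I. r * x \<in> I)"

definition ideal_gen :: "'a::comm_ring_1 set \<Rightarrow> 'a set" where
  "ideal_gen S = \<Inter>{I. is_ideal I \<and> S \<subseteq> I}"

definition ideal_prod :: "'a::comm_ring_1 set \<Rightarrow> 'a set \<Rightarrow> 'a set" where
  "ideal_prod I J = ideal_gen {x * y | x y. x \<in> I \<and> y \<in> J}"

fun ideal_pow :: "'a::comm_ring_1 set \<Rightarrow> nat \<Rightarrow> 'a set" where
  "ideal_pow I 0 = UNIV"
| "ideal_pow I (Suc n) = ideal_prod I (ideal_pow I n)"

definition colon :: "'a::comm_ring_1 set \<Rightarrow> 'a set \<Rightarrow> 'a set" where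
  "colon I J = {f. \<forall>g\<in>J. f * g \<in> I}"

definition homogeneous_ideal :: "'k::comm_ring_1 mpoly4 set \<Rightarrow> bool" where
  "homogeneous_ideal I \<longleftrightarrow> is_ideal I \<and> I = ideal_gen {f \<in> I. \<exists>d. homogeneous d f}"

definition tetrahedral :: "nat \<Rightarrow> nat \<Rightarrow> nat \<Rightarrow> nat \<Rightarrow> nat \<Rightarrow> nat \<Rightarrow> 'k::comm_ring_1 mpoly4 set" where
  "tetrahedral a1 a2 a3 a4 a5 a6 =
     ideal_pow (ideal_gen {X Va, X Vb}) a1 \<inter> ideal_pow (ideal_gen {X Va, X Vc}) a2 \<inter>
     ideal_pow (ideal_gen {X Va, X Vd}) a3 \<inter> ideal_pow (ideal_gen {X Vb, X Vc}) a4 \<inter>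
     ideal_pow (ideal_gen {X Vb, X Vd}) a5 \<inter> ideal_pow (ideal_gen {X Vc, X Vd}) a6"

text \<open>f, g homogeneous of positive degree forming a regular sequence: the ideal (f,g)
  is the homogeneous ideal of a complete intersection curve in P^3.\<close>
definition complete_intersection :: "'k::field mpoly4 \<Rightarrow> 'k mpoly4 \<Rightarrow> bool" where
  "complete_intersection f g \<longleftrightarrow>
     (\<exists>d>0. homogeneous d f) \<and> (\<exists>e>0. homogeneous e g) \<and> f \<noteq> 0 \<and>
     (\<forall>h. g * h \<in> ideal_gen {f} \<longrightarrow> h \<in> ideal_gen {f})"

definition linked :: "'k::field mpoly4 set \<Rightarrow> 'k mpoly4 set \<Rightarrow> bool" where
  "linked I J \<longleftrightarrow> homogeneous_ideal I \<and> homogeneous_ideal J \<and>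
     (\<exists>f g. complete_intersection f g \<and> ideal_gen {f, g} \<subseteq> I \<inter> J \<and>
            colon (ideal_gen {f, g}) I = J \<and> colon (ideal_gen {f, g}) J = I)"

definition evenly_linked :: "'k::field mpoly4 set \<Rightarrow> 'k mpoly4 set \<Rightarrow> bool" where
  "evenly_linked = (\<lambda>I J. \<exists>K. linked I K \<and> linked K J)\<^sup>*\<^sup>*"

text \<open>For the ideal I of a curve, dim R/I = 2, so R/I is Cohen--Macaulay iff its depth is 2,
  i.e. iff there is a homogeneous regular sequence of length 2 (of positive degrees) on R/I.\<close>
definition ACM :: "'k::field mpoly4 set \<Rightarrow> bool" where
  "ACM I \<longleftrightarrow> (\<exists>l1 l2 d1 d2. d1 > 0 \<and> d2 > 0 \<and> homogeneous d1 l1 \<and> homogeneous d2 l2 \<and>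
      (\<forall>h. l1 * h \<in> I \<longrightarrow> h \<in> I) \<and>
      (\<forall>h. l2 * h \<in> ideal_gen (insert l1 I) \<longrightarrow> h \<in> ideal_gen (insert l1 I)))"

definition in_free :: "nat \<Rightarrow> (nat \<Rightarrow> 'k::comm_ring_1 mpoly4) \<Rightarrow> bool" where
  "in_free b v \<longleftrightarrow> (\<forall>j\<ge>b. v j = 0)"

definition mat_map :: "(nat \<Rightarrow> nat \<Rightarrow> 'k::comm_ring_1 mpoly4) \<Rightarrow> nat \<Rightarrow> nat
    \<Rightarrow> (nat \<Rightarrow> 'k mpoly4) \<Rightarrow> (nat \<Rightarrow> 'k mpoly4)" where
  "mat_map M r c w = (\<lambda>i. if i < r then (\<Sum>j<c. M i j * w j) else 0)"

text \<open>I has a linear resolution: there is a graded free resolution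
  0 -> R(-d-n)^(b n) -> ... -> R(-d-1)^(b 1) -> R(-d)^(b 0) -> I -> 0,
  where R(-d)^(b 0) -> I sends the basis vectors to generators g j of degree d and
  the i-th differential is given by a matrix of linear forms M i
  (such a resolution is necessarily minimal, and its i-th module is generated in degree d+i).\<close>
definition linear_resolution :: "'k::field mpoly4 set \<Rightarrow> bool" where
  "linear_resolution I \<longleftrightarrow>
    (\<exists>(d::nat) (n::nat) (b::nat \<Rightarrow> nat) (g::nat \<Rightarrow> 'k mpoly4) (M::nat \<Rightarrow> nat \<Rightarrow> nat \<Rightarrow> 'k mpoly4).
       (\<forall>j<b 0. homogeneous d (g j)) \<and>
       I = {(\<Sum>j<b 0. v j * g j) | v. True} \<and>
       (\<forall>i\<in>{1..n}. \<forall>r c. homogeneous 1 (M i r c)) \<and>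
       {v. in_free (b 0) v \<and> (\<Sum>j<b 0. v j * g j) = 0} =
         (if n = 0 then {(\<lambda>_. 0)} else mat_map (M 1) (b 0) (b 1) ` {w. in_free (b 1) w}) \<and>
       (\<forall>i\<in>{1..n}. {v. in_free (b i) v \<and> mat_map (M i) (b (i - 1)) (b i) v = (\<lambda>_. 0)} =
         (if i = n then {(\<lambda>_. 0)}
          else mat_map (M (i + 1)) (b i) (b (i + 1)) ` {w. in_free (b (i + 1)) w})))"

end

theory Submission
  imports Defs
begin

text \<open>
  For an ideal \<open>I\<close> of \<open>R = k[a,b,c,d]\<close> the vector space \<open>Ext\<^sup>1(k, R/I)\<close> consists of families \<open>u\<close> indexed
  by the variables with \<open>x\<^sub>v u\<^sub>t - x\<^sub>t u\<^sub>v \<in> I\<close>, modulo \<open>I\<close> and the families \<open>x\<^sub>v r\<close>. It is the socle of the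
  Rao module of the curve, and its dimension is an invariant of even linkage: if \<open>I = (f,g) : K\<close> and
  \<open>I' = (f',g') : K\<close>, then the isomorphism of the canonical modules \<open>I/(f,g)\<close> and \<open>I'/(f',g')\<close>
  is given by a determinant, and it carries the cocycles of \<open>I\<close> to those of \<open>I'\<close>.

  For a tetrahedral curve everything is graded by exponents. The socle is finite-dimensional, and it
  is zero only if the curve is arithmetically Cohen--Macaulay, since then \<open>a+b+c+d\<close> and the second elementary
  symmetric polynomial form a regular sequence. A socle element belongs to a pair of opposite lines \<open>pq\<close>, \<open>rs\<close>
  with multiplicities \<open>w\<^sub>p\<^sub>q\<close>, \<open>w\<^sub>r\<^sub>s\<close>, and it lives in degree \<open>w\<^sub>p\<^sub>q + w\<^sub>r\<^sub>s - 2\<close>.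
  If the ideal has a linear resolution with generators of degree \<open>d\<close>, all socle elements have degree \<open>d - 2\<close>, so
  \<open>d = w\<^sub>p\<^sub>q + w\<^sub>r\<^sub>s\<close>. As the ideal is generated in that degree, the four other multiplicities
  are so small that the dimension of the socle is at least \<open>w\<^sub>p\<^sub>q - 2\<close> and \<open>w\<^sub>r\<^sub>s - 2\<close>.
  Hence the invariant bounds all multiplicities.
\<close>

section \<open>Koszul exactness for four regular elements\<close>

locale koszul4 =
  fixes a b c d :: "'r::idom"
  assumes a_nz: "a \<noteq> 0"
    and b_reg: "a dvd b * x \<Longrightarrow> a dvd x"
    and c_reg: "c * x = a * p + b * q \<Longrightarrow> \<exists>p' q'. x = a * p' + b * q'"
    and d_reg: "d * x = a * p + b * q + c * r \<Longrightarrow> \<exists>p' q' r'. x = a * p' + b * q' + c * r'"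
begin

lemma exact1:
  assumes "a * ub = b * ua" "a * uc = c * ua" "a * ud = d * ua"
  shows "\<exists>r. ua = a * r \<and> ub = b * r \<and> uc = c * r \<and> ud = d * r"
proof -
  have "a dvd b * ua" using assms(1) by (metis dvd_triv_left)
  then obtain r where r: "ua = a * r" using b_reg by (blast elim: dvdE)
  have "a * ub = a * (b * r)" "a * uc = a * (c * r)" "a * ud = a * (d * r)"
    using assms r by (simp_all add: mult.left_commute)
  with a_nz r show ?thesis by auto
qed

text \<open>Regularity of \<open>c\<close> modulo \<open>a\<close>, \<open>b\<close> splits
  \<open>ab\<close>; regularity of \<open>b\<close> modulo \<open>a\<close> then splits
  \<open>ac\<close> and \<open>ad\<close>. The other three entries follow by cancelling
  \<open>a\<close> in the cocycle equations.\<close>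

lemma exact2:
  assumes abc: "a * bc - b * ac + c * ab = 0" and abd: "a * bd - b * ad + d * ab = 0"
    and acd: "a * cd - c * ad + d * ac = 0"
  shows "\<exists>ya yb yc yd. ab = a * yb - b * ya \<and> ac = a * yc - c * ya \<and> ad = a * yd - d * ya
    \<and> bc = b * yc - c * yb \<and> bd = b * yd - d * yb \<and> cd = c * yd - d * yc"
proof -
  have "c * ab = a * (- bc) + b * ac" using abc by algebra
  then obtain t s where ab: "ab = a * t + b * s" using c_reg by blast
  have "b * (ac - c * s) = a * (bc + c * t)" using abc ab by algebra
  then have "a dvd ac - c * s" using b_reg by (metis dvd_triv_left)
  then obtain t' where ac: "ac - c * s = a * t'" by (blast elim: dvdE)
  have "b * (ad - d * s) = a * (bd + d * t)" using abd ab by algebra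
  then have "a dvd ad - d * s" using b_reg by (metis dvd_triv_left)
  then obtain t'' where ad: "ad - d * s = a * t''" by (blast elim: dvdE)
  have "a * bc = a * (b * t' - c * t)" using abc ab ac by algebra
  moreover have "a * bd = a * (b * t'' - d * t)" using abd ab ad by algebra
  moreover have "a * cd = a * (c * t'' - d * t')" using acd ac ad by algebra
  ultimately have "bc = b * t' - c * t \<and> bd = b * t'' - d * t \<and> cd = c * t'' - d * t'"
    using a_nz by simp
  moreover have "ab = a * t - b * (- s)" "ac = a * t' - c * (- s)" "ad = a * t'' - d * (- s)"
    using ab ac ad by algebra+
  ultimately show ?thesis by blast
qed

text \<open>The relation is solved from the last coefficient backwards, each element being regular
  modulo the previous ones. The signs make the right-hand sides the Koszul differential of a
  2-cochain.\<close>

lemma exact3: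
  assumes "a * qa + b * qb + c * qc + d * qd = 0"
  shows "\<exists>ab ac ad bc bd cd. qa = b * cd - c * bd + d * bc \<and> qb = - (a * cd - c * ad + d * ac)
    \<and> qc = a * bd - b * ad + d * ab \<and> qd = - (a * bc - b * ac + c * ab)"
proof -
  have "d * qd = a * (- qa) + b * (- qb) + c * (- qc)" using assms by algebra
  then obtain x y z where qd: "qd = a * x + b * y + c * z" using d_reg by blast
  have "c * (qc + d * z) = a * (- qa - d * x) + b * (- qb - d * y)" using assms qd by algebra
  then obtain p p' where qc: "qc + d * z = a * p + b * p'" using c_reg by blast
  have e: "b * (qb + d * y + c * p') = a * (- (qa + d * x + c * p))" using assms qd qc by algebra
  then have "a dvd qb + d * y + c * p'" using b_reg by (metis dvd_triv_left)
  then obtain r where qb: "qb + d * y + c * p' = a * r" by (blast elim: dvdE)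
  have "a * (qa + d * x + c * p) = a * (- (b * r))" using e qb by algebra
  then have qa: "qa + d * x + c * p = - (b * r)" using a_nz by (metis mult_left_cancel)
  have "qa = b * (- r) - c * p + d * (- x)" "qb = - (a * (- r) - c * (- p') + d * y)"
    "qc = a * p - b * (- p') + d * (- z)" "qd = - (a * (- x) - b * y + c * (- z))"
    using qa qb qc qd by algebra+
  then show ?thesis by blast
qed

text \<open>Dividing the cocycle defects by \<open>f\<close> gives a 2-cocycle over the ring itself.
  Its potential \<open>y\<close> corrects \<open>u\<close> to a true cocycle
  \<open>u - f * y\<close>, to which \<open>exact1\<close> applies.\<close>

lemma exact1_mod:
  assumes f: "f \<noteq> 0"
    and ab: "f dvd a * ub - b * ua" and ac: "f dvd a * uc - c * ua" and ad: "f dvd a * ud - d * ua"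
    and bc: "f dvd b * uc - c * ub" and bd: "f dvd b * ud - d * ub" and cd: "f dvd c * ud - d * uc"
  shows "\<exists>r. f dvd ua - a * r \<and> f dvd ub - b * r \<and> f dvd uc - c * r \<and> f dvd ud - d * r"
proof -
  obtain wab wac wad wbc wbd wcd where w: "a * ub - b * ua = f * wab" "a * uc - c * ua = f * wac"
    "a * ud - d * ua = f * wad" "b * uc - c * ub = f * wbc" "b * ud - d * ub = f * wbd"
    "c * ud - d * uc = f * wcd"
    using ab ac ad bc bd cd by (elim dvdE) blast
  have "f * (a * wbc - b * wac + c * wab) = 0" "f * (a * wbd - b * wad + d * wab) = 0"
    "f * (a * wcd - c * wad + d * wac) = 0" using w by algebra+
  with f have "a * wbc - b * wac + c * wab = 0" "a * wbd - b * wad + d * wab = 0"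
    "a * wcd - c * wad + d * wac = 0" by simp_all
  from exact2[OF this] obtain ya yb yc yd where y:
    "wab = a * yb - b * ya" "wac = a * yc - c * ya" "wad = a * yd - d * ya" by blast
  have "a * (ub - f * yb) = b * (ua - f * ya)" "a * (uc - f * yc) = c * (ua - f * ya)"
    "a * (ud - f * yd) = d * (ua - f * ya)" using w y by algebra+
  from exact1[OF this] obtain r where "ua - f * ya = a * r" "ub - f * yb = b * r"
    "uc - f * yc = c * r" "ud - f * yd = d * r" by blast
  then have "ua - a * r = f * ya" "ub - b * r = f * yb" "uc - c * r = f * yc" "ud - d * r = f * yd"
    by algebra+
  then show ?thesis by (metis dvd_triv_left)
qed

lemma exact1_mod2:
  assumes f: "f \<noteq> 0" and g: "\<And>x. f dvd g * x \<Longrightarrow> f dvd x"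
    and w: "a * ub - b * ua = f * wab + g * zab" "a * uc - c * ua = f * wac + g * zac"
    "a * ud - d * ua = f * wad + g * zad" "b * uc - c * ub = f * wbc + g * zbc"
    "b * ud - d * ub = f * wbd + g * zbd" "c * ud - d * uc = f * wcd + g * zcd"
  shows "\<exists>r ya yb yc yd sa sb sc sd. ua = a * r + f * ya + g * sa \<and> ub = b * r + f * yb + g * sb
    \<and> uc = c * r + f * yc + g * sc \<and> ud = d * r + f * yd + g * sd"
proof -
  \<comment> \<open>The Koszul differential kills the left-hand sides of \<open>w\<close>, so the
    differentials of the two coefficient families form a syzygy of \<open>f\<close> and
    \<open>g\<close>.\<close>
  have "g * (a * zbc - b * zac + c * zab) = f * (- (a * wbc - b * wac + c * wab))"
    "g * (a * zbd - b * zad + d * zab) = f * (- (a * wbd - b * wad + d * wab))"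
    "g * (a * zcd - c * zad + d * zac) = f * (- (a * wcd - c * wad + d * wac))"
    "g * (b * zcd - c * zbd + d * zbc) = f * (- (b * wcd - c * wbd + d * wbc))"
    using w by algebra+
  then have "f dvd a * zbc - b * zac + c * zab" "f dvd a * zbd - b * zad + d * zab"
    "f dvd a * zcd - c * zad + d * zac" "f dvd b * zcd - c * zbd + d * zbc"
    using g by (metis dvd_triv_left)+
  then obtain q1 q2 q3 q4 where q: "a * zbc - b * zac + c * zab = f * q1"
    "a * zbd - b * zad + d * zab = f * q2" "a * zcd - c * zad + d * zac = f * q3"
    "b * zcd - c * zbd + d * zbc = f * q4" by (elim dvdE) blast
  \<comment> \<open>The differential of \<open>q\<close> vanishes because \<open>f * q\<close> is
    itself a differential. A preimage of \<open>q\<close> under \<open>exact3\<close>, multiplied by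
    \<open>f\<close> and subtracted, turns the \<open>z\<close> family into a 2-cocycle.\<close>
  have "f * (a * q4 + b * (- q3) + c * q2 + d * (- q1)) = 0" using q by algebra
  with f have "a * q4 + b * (- q3) + c * q2 + d * (- q1) = 0" by simp
  from exact3[OF this] obtain ab ac ad bc bd cd where p: "q4 = b * cd - c * bd + d * bc"
    "- q3 = - (a * cd - c * ad + d * ac)" "q2 = a * bd - b * ad + d * ab"
    "- q1 = - (a * bc - b * ac + c * ab)" by blast
  have "a * (zbc - f * bc) - b * (zac - f * ac) + c * (zab - f * ab) = 0"
    "a * (zbd - f * bd) - b * (zad - f * ad) + d * (zab - f * ab) = 0"
    "a * (zcd - f * cd) - c * (zad - f * ad) + d * (zac - f * ac) = 0" using q p by algebra+
  from exact2[OF this] obtain sa sb sc sd where s: "zab - f * ab = a * sb - b * sa"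
    "zac - f * ac = a * sc - c * sa" "zad - f * ad = a * sd - d * sa"
    "zbc - f * bc = b * sc - c * sb" "zbd - f * bd = b * sd - d * sb" "zcd - f * cd = c * sd - d * sc"
    by blast
  have "a * (ub - g * sb) - b * (ua - g * sa) = f * (wab + g * ab)"
    "a * (uc - g * sc) - c * (ua - g * sa) = f * (wac + g * ac)"
    "a * (ud - g * sd) - d * (ua - g * sa) = f * (wad + g * ad)"
    "b * (uc - g * sc) - c * (ub - g * sb) = f * (wbc + g * bc)"
    "b * (ud - g * sd) - d * (ub - g * sb) = f * (wbd + g * bd)"
    "c * (ud - g * sd) - d * (uc - g * sc) = f * (wcd + g * cd)" using w s by algebra+
  then have "\<exists>r. f dvd (ua - g * sa) - a * r \<and> f dvd (ub - g * sb) - b * r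
      \<and> f dvd (uc - g * sc) - c * r \<and> f dvd (ud - g * sd) - d * r"
    by (intro exact1_mod f) (metis dvd_triv_left)+
  then obtain r ya yb yc yd where "(ua - g * sa) - a * r = f * ya" "(ub - g * sb) - b * r = f * yb"
      "(uc - g * sc) - c * r = f * yc" "(ud - g * sd) - d * r = f * yd" by (elim exE conjE dvdE) blast
  then have "ua = a * r + f * ya + g * sa" "ub = b * r + f * yb + g * sb"
    "uc = c * r + f * yc + g * sc" "ud = d * r + f * yd + g * sd" by algebra+
  then show ?thesis by blast
qed

text \<open>The coefficients \<open>qa\<close>, ..., \<open>qd\<close> of \<open>g\<close> form a
  1-cocycle modulo \<open>f\<close>, hence are multiples of the variables by some \<open>r\<close>
  modulo \<open>f\<close>. Then the quotients of \<open>y - g * r\<close> times the variables by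
  \<open>f\<close> are a true 1-cocycle, and \<open>y - g * r\<close> is a multiple of
  \<open>f\<close>.\<close>

lemma exact0_mod2:
  assumes f: "f \<noteq> 0" and g: "\<And>x. f dvd g * x \<Longrightarrow> f dvd x"
    and y: "a * y = f * pa + g * qa" "b * y = f * pb + g * qb" "c * y = f * pc + g * qc"
      "d * y = f * pd + g * qd"
  shows "\<exists>p q. y = f * p + g * q"
proof -
  have "g * (a * qb - b * qa) = f * (b * pa - a * pb)" "g * (a * qc - c * qa) = f * (c * pa - a * pc)"
    "g * (a * qd - d * qa) = f * (d * pa - a * pd)" "g * (b * qc - c * qb) = f * (c * pb - b * pc)"
    "g * (b * qd - d * qb) = f * (d * pb - b * pd)" "g * (c * qd - d * qc) = f * (d * pc - c * pd)"
    using y by algebra+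
  then have "f dvd a * qb - b * qa" "f dvd a * qc - c * qa" "f dvd a * qd - d * qa"
    "f dvd b * qc - c * qb" "f dvd b * qd - d * qb" "f dvd c * qd - d * qc"
    using g by (metis dvd_triv_left)+
  from exact1_mod[OF f this] obtain r sa sb sc sd where s: "qa - a * r = f * sa" "qb - b * r = f * sb"
    "qc - c * r = f * sc" "qd - d * r = f * sd" by (elim exE conjE dvdE) blast
  have e: "a * (y - g * r) = f * (pa + g * sa)" "b * (y - g * r) = f * (pb + g * sb)"
     "c * (y - g * r) = f * (pc + g * sc)" "d * (y - g * r) = f * (pd + g * sd)" using y s by algebra+
  have "f * (a * (pb + g * sb)) = f * (b * (pa + g * sa))"
    "f * (a * (pc + g * sc)) = f * (c * (pa + g * sa))"
    "f * (a * (pd + g * sd)) = f * (d * (pa + g * sa))" using e by algebra+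
  with f have "a * (pb + g * sb) = b * (pa + g * sa)" "a * (pc + g * sc) = c * (pa + g * sa)"
    "a * (pd + g * sd) = d * (pa + g * sa)" by simp_all
  from exact1[OF this] obtain t where "pa + g * sa = a * t" by blast
  with e have "a * (y - g * r) = a * (f * t)" by algebra
  with a_nz have "y - g * r = f * t" by simp
  then have "y = f * t + g * r" by algebra
  then show ?thesis by blast
qed

end

section \<open>The polynomial ring\<close>

text \<open>A linear order of the variables is what the library requires to make the polynomial ring an integral domain.\<close>

instantiation var :: linorder
begin
definition var_idx :: "var \<Rightarrow> nat" where
  "var_idx v = (case v of Va \<Rightarrow> 0 | Vb \<Rightarrow> 1 | Vc \<Rightarrow> 2 | Vd \<Rightarrow> 3)"
definition "v \<le> w \<longleftrightarrow> var_idx v \<le> var_idx w"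
definition "v < w \<longleftrightarrow> var_idx v < var_idx w"
instance
  by standard (auto simp: less_eq_var_def less_var_def var_idx_def split: var.splits)
end

abbreviation lookup where "lookup \<equiv> Poly_Mapping.lookup"
abbreviation keys where "keys \<equiv> Poly_Mapping.keys"
abbreviation single where "single \<equiv> Poly_Mapping.single"

lemma UNIV_var: "(UNIV :: var set) = {Va, Vb, Vc, Vd}"
  by (auto intro: var.exhaust)

instance var :: finite
  by standard (simp add: UNIV_var)

definition ev :: "var \<Rightarrow> (var \<Rightarrow>\<^sub>0 nat)" where
  "ev v = single v 1"

lemma X_ev: "X v = single (ev v) 1"
  by (simp add: X_def ev_def)

lemma lookup_single_mult:
  fixes F :: "'k::comm_ring_1 mpoly4"
  shows "lookup (single a c * F) (a + m) = c * lookup F m"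
  by (simp add: lookup_mult lookup_single when_mult)

lemma lookup_ev: "lookup (ev v) w = (if v = w then 1 else 0)"
  by (simp add: ev_def lookup_single when_def)

lemma diff_ev_add: "lookup m v \<noteq> 0 \<Longrightarrow> m - ev v + ev v = m"
  by (rule poly_mapping_eqI) (auto simp: lookup_add lookup_minus lookup_ev)

lemma lookup_X_mult [simp]:
  fixes F :: "'k::comm_ring_1 mpoly4"
  shows "lookup (X v * F) (m + ev v) = lookup F m"
  using lookup_single_mult[of "ev v" 1 F m] by (simp add: X_ev add.commute)

lemma keys_X_mult:
  fixes F :: "'k::comm_ring_1 mpoly4"
  shows "keys (X v * F) = (\<lambda>m. m + ev v) ` keys F"
proof
  show "keys (X v * F) \<subseteq> (\<lambda>m. m + ev v) ` keys F"
    using keys_mult[of "X v" F] by (auto simp: X_ev add.commute split: if_splits)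
  show "(\<lambda>m. m + ev v) ` keys F \<subseteq> keys (X v * F)"
    by (auto simp: in_keys_iff)
qed

lemma lookup_X_mult_eq_0:
  fixes F :: "'k::comm_ring_1 mpoly4" and m :: "var \<Rightarrow>\<^sub>0 nat"
  assumes "lookup m v = 0" shows "lookup (X v * F) m = 0"
proof (rule ccontr)
  assume "lookup (X v * F) m \<noteq> 0"
  then have "m \<in> keys (X v * F)" by (simp add: in_keys_iff)
  with assms show False by (auto simp: keys_X_mult lookup_add lookup_ev)
qed

lemma X_mult_single: "X v * single m c = single (m + ev v) (c::'k::comm_ring_1)"
  by (simp add: X_ev mult_single add.commute)

lemma poly_sum_monomials:
  fixes F :: "'a \<Rightarrow>\<^sub>0 'b::comm_monoid_add"
  shows "F = (\<Sum>m\<in>keys F. single m (lookup F m))"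
  by (rule poly_mapping_eqI)
     (simp add: lookup_sum lookup_single when_def sum.delta in_keys_iff)

lemma keys_sum_subset: "keys (\<Sum>i\<in>S. h i :: 'a \<Rightarrow>\<^sub>0 'b::comm_monoid_add) \<subseteq> (\<Union>i\<in>S. keys (h i))"
proof
  fix m assume "m \<in> keys (\<Sum>i\<in>S. h i)"
  then have "(\<Sum>i\<in>S. lookup (h i) m) \<noteq> 0" by (simp add: in_keys_iff lookup_sum)
  then show "m \<in> (\<Union>i\<in>S. keys (h i))"
    by (auto simp: in_keys_iff elim: sum.not_neutral_contains_not_neutral)
qed

lemma is_ideal_sum:
  assumes "is_ideal J" "\<And>i. i \<in> S \<Longrightarrow> h i \<in> J" shows "sum h S \<in> J"
  using assms(2) by (induction S rule: infinite_finite_induct) (use assms(1) in \<open>auto simp: is_ideal_def\<close>)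

lemma is_ideal_uminus:
  assumes "is_ideal J" "x \<in> J" shows "- x \<in> J"
proof -
  have "(-1) * x \<in> J" using assms unfolding is_ideal_def by blast
  then show ?thesis by simp
qed

lemma is_ideal_diff:
  assumes "is_ideal J" "x \<in> J" "y \<in> J" shows "x - y \<in> J"
proof -
  have "x + - y \<in> J" using assms is_ideal_uminus[OF assms(1,3)] unfolding is_ideal_def by blast
  then show ?thesis by simp
qed

lemma ideal_memI_monomials:
  fixes F :: "'k::comm_ring_1 mpoly4"
  assumes "is_ideal J" "\<And>m. m \<in> keys F \<Longrightarrow> single m (lookup F m) \<in> J"
  shows "F \<in> J"
  by (subst poly_sum_monomials) (rule is_ideal_sum[OF assms])

text \<open>An ideal generated by variables is monomial, so membership is decided on each exponent
  separately.\<close>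

lemma var_ideal_iff:
  fixes F :: "'k::comm_ring_1 mpoly4"
  shows "(\<exists>p. F = (\<Sum>v\<in>S. X v * p v)) \<longleftrightarrow> (\<forall>m\<in>keys F. \<exists>v\<in>S. lookup m v \<noteq> 0)"
proof
  assume "\<exists>p. F = (\<Sum>v\<in>S. X v * p v)"
  then obtain p where "F = (\<Sum>v\<in>S. X v * p v)" by blast
  then have "keys F \<subseteq> (\<Union>v\<in>S. keys (X v * p v))"
    by (simp only: keys_sum_subset)
  moreover have "lookup m v \<noteq> 0" if "m \<in> keys (X v * p v)" for m v
    using that by (auto simp: keys_X_mult lookup_add lookup_ev)
  ultimately show "\<forall>m\<in>keys F. \<exists>v\<in>S. lookup m v \<noteq> 0" by blast
next
  assume *: "\<forall>m\<in>keys F. \<exists>v\<in>S. lookup m v \<noteq> 0"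
  have "is_ideal {F :: 'k mpoly4. \<exists>p. F = (\<Sum>v\<in>S. X v * p v)}"
    unfolding is_ideal_def
  proof (intro conjI ballI allI)
    show "0 \<in> {F :: 'k mpoly4. \<exists>p. F = (\<Sum>v\<in>S. X v * p v)}"
      by (auto intro: exI[of _ "\<lambda>_. 0"])
  next
    fix x y :: "'k mpoly4"
    assume "x \<in> {F. \<exists>p. F = (\<Sum>v\<in>S. X v * p v)}" "y \<in> {F. \<exists>p. F = (\<Sum>v\<in>S. X v * p v)}"
    then obtain p q where "x = (\<Sum>v\<in>S. X v * p v)" "y = (\<Sum>v\<in>S. X v * q v)" by blast
    then have "x + y = (\<Sum>v\<in>S. X v * (p v + q v))" by (simp add: distrib_left sum.distrib)
    then show "x + y \<in> {F. \<exists>p. F = (\<Sum>v\<in>S. X v * p v)}"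
      by (auto intro!: exI[of _ "\<lambda>v. p v + q v"])
  next
    fix r x :: "'k mpoly4"
    assume "x \<in> {F. \<exists>p. F = (\<Sum>v\<in>S. X v * p v)}"
    then obtain p where "x = (\<Sum>v\<in>S. X v * p v)" by blast
    then have "r * x = (\<Sum>v\<in>S. X v * (r * p v))" by (simp add: sum_distrib_left mult.left_commute)
    then show "r * x \<in> {F. \<exists>p. F = (\<Sum>v\<in>S. X v * p v)}"
      by (auto intro!: exI[of _ "\<lambda>v. r * p v"])
  qed
  moreover have "\<exists>p. single m (lookup F m) = (\<Sum>v\<in>S. X v * p v)" if "m \<in> keys F" for m
  proof -
    from * that obtain v where v: "v \<in> S" "lookup m v \<noteq> 0" by blast
    let ?p = "\<lambda>w. if w = v then single (m - ev v) (lookup F m) else 0"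
    have "(\<Sum>w\<in>S. X w * ?p w) = X v * single (m - ev v) (lookup F m)"
      using v by (subst sum.remove[of _ v]) auto
    also have "\<dots> = single m (lookup F m)"
      using v by (simp add: X_mult_single diff_ev_add)
    finally show ?thesis by (intro exI[of _ ?p]) simp
  qed
  ultimately have "F \<in> {F. \<exists>p. F = (\<Sum>v\<in>S. X v * p v)}"
    using ideal_memI_monomials[of "{F. \<exists>p. F = (\<Sum>v\<in>S. X v * p v)}" F] by blast
  then show "\<exists>p. F = (\<Sum>v\<in>S. X v * p v)" by blast
qed

lemma X_regular_var_ideal:
  fixes F :: "'k::comm_ring_1 mpoly4"
  assumes "t \<notin> S" "\<exists>p. X t * F = (\<Sum>v\<in>S. X v * p v)"
  shows "\<exists>p. F = (\<Sum>v\<in>S. X v * p v)"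
  unfolding var_ideal_iff
proof
  fix m assume "m \<in> keys F"
  then have "m + ev t \<in> keys (X t * F)" by (simp add: keys_X_mult)
  with assms(2) obtain v where "v \<in> S" "lookup (m + ev t) v \<noteq> 0" unfolding var_ideal_iff by blast
  with assms(1) show "\<exists>v\<in>S. lookup m v \<noteq> 0"
    by (auto simp: lookup_add lookup_ev split: if_splits)
qed

interpretation vars: koszul4 "X Va" "X Vb" "X Vc" "X Vd :: 'k::field mpoly4"
proof
  show "(X Va :: 'k mpoly4) \<noteq> 0"
    by (metis X_ev lookup_single_eq lookup_zero zero_neq_one)
next
  fix x :: "'k mpoly4" assume "X Va dvd X Vb * x"
  then obtain p where "X Vb * x = X Va * p" by (blast elim: dvdE)
  then have "\<exists>p. x = (\<Sum>v\<in>{Va}. X v * p v)"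
    by (intro X_regular_var_ideal[of Vb "{Va}" x]) (simp, rule exI[of _ "\<lambda>_. p"], simp)
  then show "X Va dvd x" by auto
next
  fix x p q :: "'k mpoly4" assume "X Vc * x = X Va * p + X Vb * q"
  then have "\<exists>p. x = (\<Sum>v\<in>{Va, Vb}. X v * p v)"
    by (intro X_regular_var_ideal[of Vc "{Va, Vb}" x]) (simp, rule exI[of _ "\<lambda>v. if v = Va then p else q"], simp)
  then show "\<exists>p' q'. x = X Va * p' + X Vb * q'" by auto
next
  fix x p q r :: "'k mpoly4" assume "X Vd * x = X Va * p + X Vb * q + X Vc * r"
  then have "\<exists>p. x = (\<Sum>v\<in>{Va, Vb, Vc}. X v * p v)"
    by (intro X_regular_var_ideal[of Vd "{Va, Vb, Vc}" x])
       (simp, rule exI[of _ "\<lambda>v. if v = Va then p else if v = Vb then q else r"], simp add: add.assoc)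
  then show "\<exists>p' q' r'. x = X Va * p' + X Vb * q' + X Vc * r'" by (auto simp: add.assoc)
qed

section \<open>Koszul cocycles modulo zero, a principal ideal and a complete intersection\<close>

definition cocycles :: "'k::comm_ring_1 mpoly4 set \<Rightarrow> (var \<Rightarrow> 'k mpoly4) set" where
  "cocycles I = {u. \<forall>v t. X v * u t - X t * u v \<in> I}"

definition coboundaries :: "'k::comm_ring_1 mpoly4 set \<Rightarrow> (var \<Rightarrow> 'k mpoly4) set" where
  "coboundaries I = {u. \<exists>r. \<forall>v. u v - X v * r \<in> I}"

lemma all_var: "(\<forall>v. P v) \<longleftrightarrow> P Va \<and> P Vb \<and> P Vc \<and> P Vd"
  by (metis var.exhaust)

lemma cocycle_zero_exact:
  fixes u :: "var \<Rightarrow> 'k::field mpoly4"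
  assumes "\<And>v t. X v * u t = X t * u v"
  shows "\<exists>r. \<forall>v. u v = X v * r"
  unfolding all_var using vars.exact1[of "u Vb" "u Va" "u Vc" "u Vd"] assms by blast

lemma cocycle_principal_exact:
  fixes u :: "var \<Rightarrow> 'k::field mpoly4"
  assumes "f \<noteq> 0" "\<And>v t. f dvd X v * u t - X t * u v"
  shows "\<exists>r s. \<forall>v. u v = X v * r + f * s v"
proof -
  obtain r where "\<forall>v. f dvd u v - X v * r"
    unfolding all_var using vars.exact1_mod[of f "u Vb" "u Va" "u Vc" "u Vd"] assms by blast
  then have "\<forall>v. \<exists>s. u v - X v * r = f * s" by (metis dvdE)
  then obtain s where "\<forall>v. u v - X v * r = f * s v" by metis
  then have "\<forall>v. u v = X v * r + f * s v" by (metis add.commute diff_add_cancel)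
  then show ?thesis by blast
qed

text \<open>What remains of \<open>complete_intersection\<close> when degrees are forgotten; the
  transfer of cocycles is an ungraded argument.\<close>

definition regular_pair :: "'r::comm_ring_1 \<Rightarrow> 'r \<Rightarrow> bool" where
  "regular_pair f g \<longleftrightarrow> f \<noteq> 0 \<and> (\<forall>x. f dvd g * x \<longrightarrow> f dvd x)"

text \<open>This is the vanishing of Ext^1(k, R/(f,g)) for a regular pair;
  \<open>ci_saturated\<close> is the vanishing of Hom(k, R/(f,g)).\<close>

lemma cocycle_ci_exact:
  fixes u :: "var \<Rightarrow> 'k::field mpoly4"
  assumes "regular_pair f g" "\<And>v t. \<exists>p q. X v * u t - X t * u v = p * f + q * g"
  shows "\<exists>r p q. \<forall>v. u v = X v * r + p v * f + q v * g"
proof -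
  have "\<forall>v t. \<exists>p q. X v * u t - X t * u v = f * p + g * q"
    using assms(2) by (metis mult.commute)
  then obtain w z where wz: "\<And>v t. X v * u t - X t * u v = f * w v t + g * z v t" by metis
  obtain r ya yb yc yd sa sb sc sd where
    y: "u Va = X Va * r + f * ya + g * sa" "u Vb = X Vb * r + f * yb + g * sb"
       "u Vc = X Vc * r + f * yc + g * sc" "u Vd = X Vd * r + f * yd + g * sd"
    using vars.exact1_mod2[OF _ _ wz[of Va Vb] wz[of Va Vc] wz[of Va Vd] wz[of Vb Vc] wz[of Vb Vd] wz[of Vc Vd]] assms(1)
    unfolding regular_pair_def by blast
  show ?thesis
    by (rule exI[of _ r], rule exI[of _ "case_var ya yb yc yd"], rule exI[of _ "case_var sa sb sc sd"])
       (simp add: all_var y mult.commute)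
qed

lemma ci_saturated:
  fixes y :: "'k::field mpoly4"
  assumes "regular_pair f g" "\<And>v. \<exists>p q. X v * y = p * f + q * g"
  shows "\<exists>p q. y = p * f + q * g"
proof -
  have "\<forall>v. \<exists>p q. X v * y = f * p + g * q"
    using assms(2) by (metis mult.commute)
  then obtain w z where wz: "\<And>v. X v * y = f * w v + g * z v" by metis
  have "\<exists>p q. y = f * p + g * q"
    using vars.exact0_mod2[OF _ _ wz[of Va] wz[of Vb] wz[of Vc] wz[of Vd]] assms(1) unfolding regular_pair_def by blast
  then show ?thesis by (metis mult.commute)
qed

section \<open>Invariance under even linkage\<close>

lemma ideal_gen_pair:
  fixes f g :: "'r::comm_ring_1"
  shows "ideal_gen {f, g} = {p * f + q * g | p q. True}" (is "_ = ?S")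
proof
  have "is_ideal ?S"
    unfolding is_ideal_def
  proof (intro conjI ballI allI)
    show "0 \<in> ?S" by (rule CollectI, rule exI[of _ 0], rule exI[of _ 0]) simp
  next
    fix x y assume "x \<in> ?S" "y \<in> ?S"
    then obtain p q p' q' where "x = p * f + q * g" "y = p' * f + q' * g" by blast
    then have "x + y = (p + p') * f + (q + q') * g" by (simp add: algebra_simps)
    then show "x + y \<in> ?S" by blast
  next
    fix r x assume "x \<in> ?S"
    then obtain p q where "x = p * f + q * g" by blast
    then have "r * x = (r * p) * f + (r * q) * g" by (simp add: algebra_simps)
    then show "r * x \<in> ?S" by blast
  qed
  moreover have "f = 1 * f + 0 * g" "g = 0 * f + 1 * g" by simp_all
  then have "{f, g} \<subseteq> ?S" by blast
  ultimately show "ideal_gen {f, g} \<subseteq> ?S" unfolding ideal_gen_def by blast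
  show "?S \<subseteq> ideal_gen {f, g}" unfolding ideal_gen_def is_ideal_def by blast
qed

lemma ideal_gen_single: "ideal_gen {f} = {x. f dvd x}" for f :: "'r::comm_ring_1"
proof -
  have "p * f + q * f = f * (p + q)" for p q by (simp add: algebra_simps)
  moreover have "f * p = p * f + 0 * f" for p by (simp add: mult.commute)
  ultimately have "{p * f + q * f | p q. True} = {x. \<exists>k. x = f * k}" by blast
  then show ?thesis using ideal_gen_pair[of f f] by (simp add: dvd_def)
qed

lemma complete_intersection_regular: "complete_intersection f g \<Longrightarrow> regular_pair f g"
  unfolding complete_intersection_def regular_pair_def ideal_gen_single by blast

text \<open>The comparison of the canonical modules \<open>((f, g) : K) / (f, g)\<close> and \<open>((f', g') : K) / (f', g')\<close>:
  if multiplication by \<open>i\<close> is lifted to a 2x2 matrix from \<open>(f', g')\<close> to \<open>(f, g)\<close>,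
  then the determinant of that matrix is divisible by \<open>i\<close>, and the image of \<open>i\<close> is the quotient.\<close>

lemma ci_element_transfer:
  fixes f g f' g' i :: "'r::idom"
  assumes reg: "regular_pair f g"
    and e1: "i * f' = \<alpha> * f + \<beta> * g" and e2: "i * g' = \<gamma> * f + \<delta> * g"
  shows "\<exists>i'. i' * f = \<delta> * f' - \<beta> * g' \<and> i' * g = \<alpha> * g' - \<gamma> * f' \<and>
    (\<forall>\<kappa> \<rho> \<sigma>. i * \<kappa> = \<rho> * f + \<sigma> * g \<longrightarrow> (\<exists>\<tau> \<tau>'. i' * \<kappa> = \<tau> * f' + \<tau>' * g'))"
proof -
  have f: "f \<noteq> 0" and g: "\<And>x. f dvd g * x \<Longrightarrow> f dvd x"
    using reg unfolding regular_pair_def by blast+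
  \<comment> \<open>All syzygies of a regular pair are multiples of the Koszul syzygy.\<close>
  have syz: "\<exists>t. y = f * t \<and> x = - (g * t)" if "x * f + y * g = 0" for x y
  proof -
    have "g * y = f * (- x)" using that by algebra
    then have "f dvd y" using g by (metis dvd_triv_left)
    then obtain t where t: "y = f * t" by (blast elim: dvdE)
    then have "f * x = f * (- (g * t))" using that by algebra
    with f have "x = - (g * t)" by (metis mult_left_cancel)
    with t show ?thesis by blast
  qed
  show ?thesis
  proof (cases "i = 0")
    case True
    with e1 e2 have "\<alpha> * f + \<beta> * g = 0" "\<gamma> * f + \<delta> * g = 0" by simp_all
    then obtain s t where st: "\<beta> = f * s" "\<alpha> = - (g * s)" "\<delta> = f * t" "\<gamma> = - (g * t)" using syz by metis
    \<comment> \<open>Both rows of the matrix are Koszul syzygies here, so the determinant is zero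
      and the quotient by \<open>i\<close> is replaced by an explicit element.\<close>
    have "(t * f' - s * g') * f = \<delta> * f' - \<beta> * g'" "(t * f' - s * g') * g = \<alpha> * g' - \<gamma> * f'"
      using st by algebra+
    moreover have "(t * f' - s * g') * \<kappa> = (t * \<kappa>) * f' + (- s * \<kappa>) * g'" for \<kappa> by algebra
    ultimately show ?thesis by blast
  next
    case False
    let ?D = "\<alpha> * \<delta> - \<beta> * \<gamma>"
    \<comment> \<open>Cramer's rule for the two lifting equations; \<open>i'\<close> will be the
      quotient of \<open>?D\<close> by \<open>i\<close>.\<close>
    have D: "?D * f = i * (\<delta> * f' - \<beta> * g')" "?D * g = i * (\<alpha> * g' - \<gamma> * f')" using e1 e2 by algebra+
    then have "i * (g * (\<delta> * f' - \<beta> * g')) = i * (f * (\<alpha> * g' - \<gamma> * f'))" by algebra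
    with False have gf: "g * (\<delta> * f' - \<beta> * g') = f * (\<alpha> * g' - \<gamma> * f')" by simp
    then have "f dvd \<delta> * f' - \<beta> * g'" using g by (metis dvd_triv_left)
    then obtain i' where i': "\<delta> * f' - \<beta> * g' = f * i'" by (blast elim: dvdE)
    have "f * (g * i') = f * (\<alpha> * g' - \<gamma> * f')" using gf i' by algebra
    with f have i'': "g * i' = \<alpha> * g' - \<gamma> * f'" by simp
    have "f * ?D = f * (i * i')" using D i' by algebra
    with f have Di: "?D = i * i'" by simp
    have "\<exists>\<tau> \<tau>'. i' * \<kappa> = \<tau> * f' + \<tau>' * g'" if k: "i * \<kappa> = \<rho> * f + \<sigma> * g" for \<kappa> \<rho> \<sigma>
    proof (cases "\<kappa> = 0")
      case True
      then have "i' * \<kappa> = 0 * f' + 0 * g'" by simp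
      then show ?thesis by blast
    next
      case k0: False
      \<comment> \<open>Writing \<open>i * \<kappa> * f'\<close> in two ways gives a syzygy of
        \<open>f\<close> and \<open>g\<close>. Its coefficient \<open>t\<close>, and
        \<open>t'\<close> from \<open>g'\<close>, yield the coefficients of
        \<open>i' * \<kappa>\<close>.\<close>
      have "(\<kappa> * \<alpha> - \<rho> * f') * f + (\<kappa> * \<beta> - \<sigma> * f') * g = 0" using e1 k by algebra
      then obtain t where t: "\<kappa> * \<beta> - \<sigma> * f' = f * t" "\<kappa> * \<alpha> - \<rho> * f' = - (g * t)" using syz by metis
      have "(\<kappa> * \<gamma> - \<rho> * g') * f + (\<kappa> * \<delta> - \<sigma> * g') * g = 0" using e2 k by algebra
      then obtain t' where t': "\<kappa> * \<delta> - \<sigma> * g' = f * t'" "\<kappa> * \<gamma> - \<rho> * g' = - (g * t')" using syz by metis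
      have "\<kappa> * (\<rho> * \<delta> - \<sigma> * \<gamma>) = \<kappa> * (t' * i)" "\<kappa> * (\<sigma> * \<alpha> - \<rho> * \<beta>) = \<kappa> * ((- t) * i)"
        using t t' k by algebra+
      with k0 have "\<rho> * \<delta> - \<sigma> * \<gamma> = t' * i" "\<sigma> * \<alpha> - \<rho> * \<beta> = (- t) * i"
        by (metis mult_left_cancel)+
      then have "i * (i' * \<kappa>) = i * (t' * f' + (- t) * g')" using i' i'' k by algebra
      with False have "i' * \<kappa> = t' * f' + (- t) * g'" by simp
      then show ?thesis by blast
    qed
    moreover have "i' * f = \<delta> * f' - \<beta> * g'" "i' * g = \<alpha> * g' - \<gamma> * f'"
      using i' i'' by (simp_all add: mult.commute)
    ultimately show ?thesis by blast
  qed
qed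

text \<open>The first two equations lift \<open>u\<close> to a matrix at each variable, the last two
  use its adjugate for \<open>u'\<close>. The terms with \<open>P\<close>, \<open>Q\<close>,
  \<open>P'\<close>, \<open>Q'\<close> allow for coboundaries. It is a relation and not a map
  because the lifts are choices.\<close>

definition ci_rel :: "'k::field mpoly4 \<Rightarrow> 'k mpoly4 \<Rightarrow> 'k mpoly4 \<Rightarrow> 'k mpoly4 \<Rightarrow>
    (var \<Rightarrow> 'k mpoly4) \<Rightarrow> (var \<Rightarrow> 'k mpoly4) \<Rightarrow> bool" where
  "ci_rel f g f' g' u u' \<longleftrightarrow> (\<exists>P Q P' Q' \<alpha> \<beta> \<gamma> \<delta>. \<forall>v.
     u v * f' = X v * P + \<alpha> v * f + \<beta> v * g \<and> u v * g' = X v * Q + \<gamma> v * f + \<delta> v * g \<and>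
     u' v * f = X v * P' + \<delta> v * f' - \<beta> v * g' \<and> u' v * g = X v * Q' + \<alpha> v * g' - \<gamma> v * f')"

text \<open>Taking the adjugate of a 2x2 matrix is an involution, so the two pairs can exchange
  roles.\<close>

lemma ci_rel_sym:
  assumes "ci_rel f g f' g' u u'" shows "ci_rel f' g' f g u' u"
proof -
  obtain P Q P' Q' \<alpha> \<beta> \<gamma> \<delta> where *: "\<forall>v.
     u v * f' = X v * P + \<alpha> v * f + \<beta> v * g \<and> u v * g' = X v * Q + \<gamma> v * f + \<delta> v * g \<and>
     u' v * f = X v * P' + \<delta> v * f' - \<beta> v * g' \<and> u' v * g = X v * Q' + \<alpha> v * g' - \<gamma> v * f'"
    using assms unfolding ci_rel_def by blast
  show ?thesis unfolding ci_rel_def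
    by (rule exI[of _ P'], rule exI[of _ Q'], rule exI[of _ P], rule exI[of _ Q],
        rule exI[of _ \<delta>], rule exI[of _ "\<lambda>v. - \<beta> v"], rule exI[of _ "\<lambda>v. - \<gamma> v"], rule exI[of _ \<alpha>])
       (use * in simp)
qed

text \<open>The adjugate of a 2x2 matrix depends linearly on the matrix.\<close>

lemma ci_rel_sum:
  assumes "\<And>i. i \<in> S \<Longrightarrow> ci_rel f g f' g' (U i) (U' i)"
  shows "ci_rel f g f' g' (\<lambda>v. \<Sum>i\<in>S. c i * U i v) (\<lambda>v. \<Sum>i\<in>S. c i * U' i v)"
proof -
  have "\<forall>i\<in>S. \<exists>P Q P' Q' \<alpha> \<beta> \<gamma> \<delta>. \<forall>v.
     U i v * f' = X v * P + \<alpha> v * f + \<beta> v * g \<and> U i v * g' = X v * Q + \<gamma> v * f + \<delta> v * g \<and>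
     U' i v * f = X v * P' + \<delta> v * f' - \<beta> v * g' \<and> U' i v * g = X v * Q' + \<alpha> v * g' - \<gamma> v * f'"
    using assms unfolding ci_rel_def by blast
  then obtain P Q P' Q' \<alpha> \<beta> \<gamma> \<delta> where *: "\<And>i v. i \<in> S \<Longrightarrow>
     U i v * f' = X v * P i + \<alpha> i v * f + \<beta> i v * g \<and> U i v * g' = X v * Q i + \<gamma> i v * f + \<delta> i v * g \<and>
     U' i v * f = X v * P' i + \<delta> i v * f' - \<beta> i v * g' \<and> U' i v * g = X v * Q' i + \<alpha> i v * g' - \<gamma> i v * f'"
    by metis
  have sums: "(\<Sum>i\<in>S. c i * U i v) * f' = X v * (\<Sum>i\<in>S. c i * P i) + (\<Sum>i\<in>S. c i * \<alpha> i v) * f + (\<Sum>i\<in>S. c i * \<beta> i v) * g"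
    "(\<Sum>i\<in>S. c i * U i v) * g' = X v * (\<Sum>i\<in>S. c i * Q i) + (\<Sum>i\<in>S. c i * \<gamma> i v) * f + (\<Sum>i\<in>S. c i * \<delta> i v) * g"
    "(\<Sum>i\<in>S. c i * U' i v) * f = X v * (\<Sum>i\<in>S. c i * P' i) + (\<Sum>i\<in>S. c i * \<delta> i v) * f' - (\<Sum>i\<in>S. c i * \<beta> i v) * g'"
    "(\<Sum>i\<in>S. c i * U' i v) * g = X v * (\<Sum>i\<in>S. c i * Q' i) + (\<Sum>i\<in>S. c i * \<alpha> i v) * g' - (\<Sum>i\<in>S. c i * \<gamma> i v) * f'" for v
    unfolding sum_distrib_left sum_distrib_right sum.distrib[symmetric] sum_subtractf[symmetric]
    by (rule sum.cong[OF refl], drule *[of _ v], algebra)+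
  show ?thesis unfolding ci_rel_def
    by (rule exI[of _ "\<Sum>i\<in>S. c i * P i"], rule exI[of _ "\<Sum>i\<in>S. c i * Q i"],
        rule exI[of _ "\<Sum>i\<in>S. c i * P' i"], rule exI[of _ "\<Sum>i\<in>S. c i * Q' i"],
        rule exI[of _ "\<lambda>v. \<Sum>i\<in>S. c i * \<alpha> i v"], rule exI[of _ "\<lambda>v. \<Sum>i\<in>S. c i * \<beta> i v"],
        rule exI[of _ "\<lambda>v. \<Sum>i\<in>S. c i * \<gamma> i v"], rule exI[of _ "\<lambda>v. \<Sum>i\<in>S. c i * \<delta> i v"])
       (intro allI conjI sums)
qed

text \<open>For each element of \<open>K\<close>, multiplication turns \<open>u\<close> into a
  cocycle modulo \<open>(f, g)\<close>, which is exact. Doing this for \<open>f'\<close> and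
  \<open>g'\<close> gives the matrices, and \<open>u'\<close> is built from their adjugates.\<close>

lemma ci_transfer_cocycle:
  fixes f g f' g' :: "'k::field mpoly4"
  assumes reg: "regular_pair f g" and f'K: "f' \<in> K" and g'K: "g' \<in> K"
    and I: "I = colon (ideal_gen {f, g}) K" and I': "I' = colon (ideal_gen {f', g'}) K"
    and u: "u \<in> cocycles I"
  shows "\<exists>u'\<in>cocycles I'. ci_rel f g f' g' u u'"
proof -
  have f: "f \<noteq> 0" using reg by (simp add: regular_pair_def)
  have IK: "\<exists>p q. i * \<kappa> = p * f + q * g" if "i \<in> I" "\<kappa> \<in> K" for i \<kappa>
    using that unfolding I colon_def ideal_gen_pair by blast
  define w where "w v t = X v * u t - X t * u v" for v t
  have wI: "w v t \<in> I" for v t using u unfolding cocycles_def w_def by blast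
  have "X v * (u t * \<kappa>) - X t * (u v * \<kappa>) = w v t * \<kappa>" for v t \<kappa>
    unfolding w_def by (simp add: algebra_simps)
  then have lift: "\<exists>r p q. \<forall>v. u v * \<kappa> = X v * r + p v * f + q v * g" if "\<kappa> \<in> K" for \<kappa>
    using IK[OF wI that] by (intro cocycle_ci_exact[OF reg]) simp
  obtain P \<alpha> \<beta> where e1: "\<And>v. u v * f' = X v * P + \<alpha> v * f + \<beta> v * g" using lift[OF f'K] by blast
  obtain Q \<gamma> \<delta> where e2: "\<And>v. u v * g' = X v * Q + \<gamma> v * f + \<delta> v * g" using lift[OF g'K] by blast
  have w1: "w v t * f' = (X v * \<alpha> t - X t * \<alpha> v) * f + (X v * \<beta> t - X t * \<beta> v) * g" for v t
  proof -
    have "w v t * f' = X v * (u t * f') - X t * (u v * f')" by (simp add: w_def algebra_simps)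
    then show ?thesis unfolding e1 by (simp add: algebra_simps)
  qed
  have w2: "w v t * g' = (X v * \<gamma> t - X t * \<gamma> v) * f + (X v * \<delta> t - X t * \<delta> v) * g" for v t
  proof -
    have "w v t * g' = X v * (u t * g') - X t * (u v * g')" by (simp add: w_def algebra_simps)
    then show ?thesis unfolding e2 by (simp add: algebra_simps)
  qed
  \<comment> \<open>The matrices of the elements \<open>w v t\<close> of \<open>I\<close> are Koszul
    differentials of those of \<open>u\<close>; the transfer of single elements sends them into
    \<open>I'\<close>.\<close>
  have "\<exists>i'. i' * f = (X v * \<delta> t - X t * \<delta> v) * f' - (X v * \<beta> t - X t * \<beta> v) * g' \<and>
      i' * g = (X v * \<alpha> t - X t * \<alpha> v) * g' - (X v * \<gamma> t - X t * \<gamma> v) * f' \<and> i' \<in> I'" for v t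
    using ci_element_transfer[OF reg w1 w2, of v t] IK[OF wI, of _ v t]
    unfolding I' colon_def ideal_gen_pair by blast
  then obtain w' where w'f: "\<And>v t. w' v t * f = (X v * \<delta> t - X t * \<delta> v) * f' - (X v * \<beta> t - X t * \<beta> v) * g'"
    and w'g: "\<And>v t. w' v t * g = (X v * \<alpha> t - X t * \<alpha> v) * g' - (X v * \<gamma> t - X t * \<gamma> v) * f'"
    and w'I: "\<And>v t. w' v t \<in> I'" by metis
  define y where "y v = \<delta> v * f' - \<beta> v * g'" for v
  define z where "z v = \<alpha> v * g' - \<gamma> v * f'" for v
  have wy: "X v * y t - X t * y v = w' v t * f" for v t
    unfolding w'f y_def by (simp add: algebra_simps)
  have wz: "X v * z t - X t * z v = w' v t * g" for v t
    unfolding w'g z_def by (simp add: algebra_simps)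
  \<comment> \<open>Modulo \<open>f\<close> the family \<open>y\<close> is a cocycle, hence a
    multiple of the variables; the remaining multiple of \<open>f\<close> defines
    \<open>u'\<close>.\<close>
  obtain P' u' where u': "\<And>v. y v = X v * P' + f * u' v"
    using cocycle_principal_exact[OF f, of y] wy by fastforce
  have w'u': "w' v t = X v * u' t - X t * u' v" for v t
  proof -
    have "w' v t * f = (X v * u' t - X t * u' v) * f" using wy[of v t] unfolding u' by (simp add: algebra_simps)
    with f show ?thesis by simp
  qed
  have "X v * (z t - g * u' t) = X t * (z v - g * u' v)" for v t
    using wz[of v t] unfolding w'u' by algebra
  then obtain Q' where "\<And>v. z v - g * u' v = X v * Q'"
    using cocycle_zero_exact[of "\<lambda>v. z v - g * u' v"] by blast
  then have Q': "z v = X v * Q' + g * u' v" for v by (metis diff_add_cancel)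
  have "u' v * f = X v * (- P') + \<delta> v * f' - \<beta> v * g'" for v
    using u'[of v] y_def[of v] by algebra
  moreover have "u' v * g = X v * (- Q') + \<alpha> v * g' - \<gamma> v * f'" for v
    using Q'[of v] z_def[of v] by algebra
  ultimately have "ci_rel f g f' g' u u'"
    unfolding ci_rel_def using e1 e2 by blast
  moreover have "u' \<in> cocycles I'" unfolding cocycles_def using w'I w'u' by simp
  ultimately show ?thesis by blast
qed

text \<open>Saturation of \<open>(f, g)\<close> shows that \<open>P\<close> and \<open>Q\<close>
  agree with \<open>r * f'\<close> and \<open>r * g'\<close> modulo \<open>(f, g)\<close>. So the
  matrices of \<open>u\<close>, changed by multiples of the variables, are those of the elements
  \<open>u v - X v * r\<close> of \<open>I\<close>. Transferring these into \<open>I'\<close> leaves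
  a multiple of the variables in \<open>u'\<close>.\<close>

lemma ci_transfer_coboundary:
  fixes f g f' g' :: "'k::field mpoly4"
  assumes reg: "regular_pair f g" and f'K: "f' \<in> K" and g'K: "g' \<in> K"
    and I: "I = colon (ideal_gen {f, g}) K" and I': "I' = colon (ideal_gen {f', g'}) K"
    and u: "u \<in> coboundaries I" and rel: "ci_rel f g f' g' u u'"
  shows "u' \<in> coboundaries I'"
proof -
  have f: "f \<noteq> 0" using reg by (simp add: regular_pair_def)
  have IK: "\<exists>p q. i * \<kappa> = p * f + q * g" if "i \<in> I" "\<kappa> \<in> K" for i \<kappa>
    using that unfolding I colon_def ideal_gen_pair by blast
  obtain P Q P' Q' \<alpha> \<beta> \<gamma> \<delta> where e: "\<And>v. u v * f' = X v * P + \<alpha> v * f + \<beta> v * g"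
    "\<And>v. u v * g' = X v * Q + \<gamma> v * f + \<delta> v * g"
    "\<And>v. u' v * f = X v * P' + \<delta> v * f' - \<beta> v * g'" "\<And>v. u' v * g = X v * Q' + \<alpha> v * g' - \<gamma> v * f'"
    using rel unfolding ci_rel_def by blast
  obtain r where r: "\<And>v. u v - X v * r \<in> I" using u unfolding coboundaries_def by blast
  have "\<exists>p q. X v * (P - r * f') = p * f + q * g" for v
  proof -
    obtain p q where "(u v - X v * r) * f' = p * f + q * g" using IK[OF r f'K] by blast
    then have "X v * (P - r * f') = (p - \<alpha> v) * f + (q - \<beta> v) * g" using e(1)[of v] by algebra
    then show ?thesis by blast
  qed
  then obtain m n where mn: "P - r * f' = m * f + n * g" using ci_saturated[OF reg] by blast
  have "\<exists>p q. X v * (Q - r * g') = p * f + q * g" for v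
  proof -
    obtain p q where "(u v - X v * r) * g' = p * f + q * g" using IK[OF r g'K] by blast
    then have "X v * (Q - r * g') = (p - \<gamma> v) * f + (q - \<delta> v) * g" using e(2)[of v] by algebra
    then show ?thesis by blast
  qed
  then obtain m' n' where mn': "Q - r * g' = m' * f + n' * g" using ci_saturated[OF reg] by blast
  have "\<exists>i'. i' * f = (\<delta> v + X v * n') * f' - (\<beta> v + X v * n) * g' \<and> i' \<in> I'" for v
  proof -
    have 1: "(u v - X v * r) * f' = (\<alpha> v + X v * m) * f + (\<beta> v + X v * n) * g"
      using e(1)[of v] mn by algebra
    have 2: "(u v - X v * r) * g' = (\<gamma> v + X v * m') * f + (\<delta> v + X v * n') * g"
      using e(2)[of v] mn' by algebra
    show ?thesis
      using ci_element_transfer[OF reg 1 2] IK[OF r, of _ v]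
      unfolding I' colon_def ideal_gen_pair by blast
  qed
  then obtain i' where i'f: "\<And>v. i' v * f = (\<delta> v + X v * n') * f' - (\<beta> v + X v * n) * g'"
    and i'I: "\<And>v. i' v \<in> I'" by metis
  have P'': "(u' v - i' v) * f = X v * (P' - n' * f' + n * g')" for v
    using e(3)[of v] i'f[of v] by algebra
  have "X v * (u' t - i' t) = X t * (u' v - i' v)" for v t
  proof -
    have "(X v * (u' t - i' t)) * f = (X t * (u' v - i' v)) * f"
      using P''[of v] P''[of t] by algebra
    with f show ?thesis by simp
  qed
  then obtain r' where "\<And>v. u' v - i' v = X v * r'"
    using cocycle_zero_exact[of "\<lambda>v. u' v - i' v"] by blast
  then have "u' v - X v * r' = i' v" for v by (metis add.commute add_diff_cancel diff_add_cancel)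
  then have "\<forall>v. u' v - X v * r' \<in> I'" using i'I by simp
  then show ?thesis unfolding coboundaries_def by blast
qed

text \<open>Independent classes over \<open>k\<close>, with scalars as constant polynomials, express
  the dimension of Ext^1(k, R/I) without forming the quotient space.\<close>

definition ext_dim_ge :: "nat \<Rightarrow> 'k::field mpoly4 set \<Rightarrow> bool" where
  "ext_dim_ge n I \<longleftrightarrow> (\<exists>U. (\<forall>i<n. U i \<in> cocycles I) \<and>
     (\<forall>c. (\<lambda>v. \<Sum>i<n. single 0 (c i) * U i v) \<in> coboundaries I \<longrightarrow> (\<forall>i<n. c i = 0)))"

text \<open>Independent classes are transferred from \<open>I\<close> to \<open>J\<close> through
  \<open>K\<close>; a relation between their images is carried back by the symmetry and linearity of
  \<open>ci_rel\<close>.\<close>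

lemma ext_dim_ge_double_link:
  assumes "linked I K" "linked K J" "ext_dim_ge n I" shows "ext_dim_ge n J"
proof -
  obtain f g where fg: "complete_intersection f g" "ideal_gen {f, g} \<subseteq> I \<inter> K"
    "colon (ideal_gen {f, g}) K = I" using assms(1) unfolding linked_def by blast
  obtain f' g' where fg': "complete_intersection f' g'" "ideal_gen {f', g'} \<subseteq> K \<inter> J"
    "colon (ideal_gen {f', g'}) K = J" using assms(2) unfolding linked_def by blast
  have "{f, g} \<subseteq> ideal_gen {f, g}" "{f', g'} \<subseteq> ideal_gen {f', g'}" unfolding ideal_gen_def by blast+
  with fg fg' have K: "f \<in> K" "g \<in> K" "f' \<in> K" "g' \<in> K" by blast+
  note reg = complete_intersection_regular[OF fg(1)] and reg' = complete_intersection_regular[OF fg'(1)]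
  obtain U where U: "\<And>i. i < n \<Longrightarrow> U i \<in> cocycles I"
    and ind: "\<And>c. (\<lambda>v. \<Sum>i<n. single 0 (c i) * U i v) \<in> coboundaries I \<Longrightarrow> \<forall>i<n. c i = 0"
    using assms(3) unfolding ext_dim_ge_def by blast
  have "\<forall>i\<in>{..<n}. \<exists>u'\<in>cocycles J. ci_rel f g f' g' (U i) u'"
    using ci_transfer_cocycle[OF reg K(3,4) fg(3)[symmetric] fg'(3)[symmetric]] U by blast
  then obtain U' where U': "\<And>i. i < n \<Longrightarrow> U' i \<in> cocycles J"
    "\<And>i. i \<in> {..<n} \<Longrightarrow> ci_rel f g f' g' (U i) (U' i)" by (metis lessThan_iff)
  have "\<forall>i<n. c i = 0" if "(\<lambda>v. \<Sum>i<n. single 0 (c i) * U' i v) \<in> coboundaries J" for c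
    by (rule ind, rule ci_transfer_coboundary[OF reg' K(1,2) fg'(3)[symmetric] fg(3)[symmetric] that],
        rule ci_rel_sym, rule ci_rel_sum, rule U'(2))
  with U'(1) show ?thesis unfolding ext_dim_ge_def by blast
qed

lemma linked_sym: "linked I J \<Longrightarrow> linked J I"
  unfolding linked_def by (metis inf_commute)

lemma ext_dim_ge_evenly_linked:
  assumes "evenly_linked I J" shows "ext_dim_ge n I \<longleftrightarrow> ext_dim_ge n J"
  using assms unfolding evenly_linked_def
proof (induction rule: rtranclp_induct)
  case (step J J')
  then show ?case by (blast intro: ext_dim_ge_double_link linked_sym)
qed simp

section \<open>Tetrahedral ideals\<close>

lemma is_ideal_ideal_gen: "is_ideal (ideal_gen S)"
  unfolding ideal_gen_def is_ideal_def by blast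

lemma ideal_gen_superset: "S \<subseteq> ideal_gen S"
  unfolding ideal_gen_def by blast

lemma ideal_gen_least: "is_ideal J \<Longrightarrow> S \<subseteq> J \<Longrightarrow> ideal_gen S \<subseteq> J"
  unfolding ideal_gen_def by blast

section \<open>Monomial description of powers of line ideals and of tetrahedral ideals\<close>

definition monomial_ideal :: "((var \<Rightarrow>\<^sub>0 nat) \<Rightarrow> bool) \<Rightarrow> 'k::comm_ring_1 mpoly4 set" where
  "monomial_ideal P = {F. \<forall>m\<in>keys F. P m}"

lemma is_ideal_monomial_ideal:
  assumes "\<And>m m'. P m \<Longrightarrow> P (m' + m)"
  shows "is_ideal (monomial_ideal P :: 'k::comm_ring_1 mpoly4 set)"
  unfolding is_ideal_def
proof (intro conjI ballI allI)
  fix x y :: "'k mpoly4" assume "x \<in> monomial_ideal P" "y \<in> monomial_ideal P"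
  then show "x + y \<in> monomial_ideal P" using Poly_Mapping.keys_add[of x y] by (auto simp: monomial_ideal_def)
next
  fix r x :: "'k mpoly4" assume "x \<in> monomial_ideal P"
  then show "r * x \<in> monomial_ideal P"
    using keys_mult[of r x] assms by (fastforce simp: monomial_ideal_def)
qed (simp add: monomial_ideal_def)

lemma ideal_pow_vars:
  "ideal_pow (ideal_gen {X p, X q}) n = (monomial_ideal (\<lambda>m. n \<le> lookup m p + lookup m q) :: 'k::comm_ring_1 mpoly4 set)"
  if "p \<noteq> q"
proof (induction n)
  case 0 then show ?case by (simp add: monomial_ideal_def)
next
  case (Suc n)
  let ?M = "\<lambda>n. monomial_ideal (\<lambda>m. n \<le> lookup m p + lookup m q) :: 'k mpoly4 set"
  have ide: "is_ideal (?M n)" for n by (rule is_ideal_monomial_ideal) (auto simp: lookup_add)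
  show ?case
  proof
    have "x * y \<in> ?M (Suc n)" if x: "x \<in> ideal_gen {X p, X q}" and y: "y \<in> ?M n" for x y
    proof -
      obtain r s where "x = r * X p + s * X q" using x unfolding ideal_gen_pair by blast
      then have "x * y = r * (X p * y) + s * (X q * y)" by (simp add: algebra_simps)
      moreover have "X p * y \<in> ?M (Suc n)" "X q * y \<in> ?M (Suc n)"
        using y by (fastforce simp: monomial_ideal_def keys_X_mult lookup_add lookup_ev)+
      then have "r * (X p * y) \<in> ?M (Suc n)" "s * (X q * y) \<in> ?M (Suc n)"
        using ide[of "Suc n"] unfolding is_ideal_def by blast+
      ultimately show ?thesis using ide[of "Suc n"] unfolding is_ideal_def by simp
    qed
    then show "ideal_pow (ideal_gen {X p, X q}) (Suc n) \<subseteq> ?M (Suc n)"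
      unfolding ideal_pow.simps ideal_prod_def Suc.IH by (intro ideal_gen_least ide) auto
  next
    show "?M (Suc n) \<subseteq> ideal_pow (ideal_gen {X p, X q}) (Suc n)"
    proof
      fix F :: "'k mpoly4" assume F: "F \<in> ?M (Suc n)"
      have id: "is_ideal (ideal_pow (ideal_gen {X p, X q}) (Suc n) :: 'k mpoly4 set)"
        by (simp add: ideal_prod_def is_ideal_ideal_gen)
      show "F \<in> ideal_pow (ideal_gen {X p, X q}) (Suc n)"
      proof (rule ideal_memI_monomials[OF id])
        fix m assume "m \<in> keys F"
        then have m: "Suc n \<le> lookup m p + lookup m q" using F by (auto simp: monomial_ideal_def)
        then have "lookup m p \<noteq> 0 \<or> lookup m q \<noteq> 0" by linarith
        then obtain v where v: "v \<in> {p, q}" "lookup m v \<noteq> 0" by blast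
        have "single (m - ev v) (lookup F m) \<in> ?M n"
          using m v that by (auto simp: monomial_ideal_def lookup_minus lookup_ev split: if_splits)
        moreover have "single m (lookup F m) = X v * single (m - ev v) (lookup F m)"
          using v by (simp add: X_mult_single diff_ev_add)
        moreover have "X v \<in> ideal_gen {X p, X q}" using v ideal_gen_superset[of "{X p, X q}"] by auto
        ultimately show "single m (lookup F m) \<in> ideal_pow (ideal_gen {X p, X q}) (Suc n)"
          unfolding ideal_pow.simps ideal_prod_def Suc.IH
          by (intro subsetD[OF ideal_gen_superset]) blast
      qed
    qed
  qed
qed

text \<open>Indexing the multiplicities by unordered pairs lets any labelling of two opposite lines
  be treated alike. The value \<open>0\<close> at equal arguments is ignored by
  \<open>meets\<close>.\<close>

definition edge_weight :: "nat \<Rightarrow> nat \<Rightarrow> nat \<Rightarrow> nat \<Rightarrow> nat \<Rightarrow> nat \<Rightarrow> var \<Rightarrow> var \<Rightarrow> nat" where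
  "edge_weight a1 a2 a3 a4 a5 a6 p q =
    (if {p, q} = {Va, Vb} then a1 else if {p, q} = {Va, Vc} then a2 else if {p, q} = {Va, Vd} then a3
     else if {p, q} = {Vb, Vc} then a4 else if {p, q} = {Vb, Vd} then a5
     else if {p, q} = {Vc, Vd} then a6 else 0)"

definition meets :: "(var \<Rightarrow> var \<Rightarrow> nat) \<Rightarrow> (var \<Rightarrow>\<^sub>0 nat) \<Rightarrow> bool" where
  "meets w m \<longleftrightarrow> (\<forall>p q. p \<noteq> q \<longrightarrow> w p q \<le> lookup m p + lookup m q)"

lemma edge_weight_sym: "edge_weight a1 a2 a3 a4 a5 a6 p q = edge_weight a1 a2 a3 a4 a5 a6 q p"
  by (simp add: edge_weight_def insert_commute)

lemma tetrahedral_monomial: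
  "tetrahedral a1 a2 a3 a4 a5 a6 = (monomial_ideal (meets (edge_weight a1 a2 a3 a4 a5 a6)) :: 'k::comm_ring_1 mpoly4 set)"
proof -
  have "meets (edge_weight a1 a2 a3 a4 a5 a6) m \<longleftrightarrow>
    a1 \<le> lookup m Va + lookup m Vb \<and> a2 \<le> lookup m Va + lookup m Vc \<and> a3 \<le> lookup m Va + lookup m Vd \<and>
    a4 \<le> lookup m Vb + lookup m Vc \<and> a5 \<le> lookup m Vb + lookup m Vd \<and> a6 \<le> lookup m Vc + lookup m Vd" for m
    unfolding meets_def all_var by (auto simp: edge_weight_def doubleton_eq_iff add.commute)
  then show ?thesis
    unfolding tetrahedral_def by (auto simp: ideal_pow_vars monomial_ideal_def)
qed

lemma meets_mono: "meets w m \<Longrightarrow> meets w (m' + m)"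
  unfolding meets_def by (force simp: lookup_add intro: trans_le_add2)

lemma is_ideal_meets: "is_ideal (monomial_ideal (meets w))"
  by (rule is_ideal_monomial_ideal) (rule meets_mono)

text \<open>For \<open>m\<close> outside the ideal, the degree complex has an edge \<open>rs\<close> exactly if the complementary line \<open>pq\<close>
  is not met. It is disconnected, so that the Rao module is nonzero in degree \<open>m\<close>,
  exactly if its edges are \<open>pq\<close> and \<open>rs\<close>.\<close>

definition critical :: "(var \<Rightarrow> var \<Rightarrow> nat) \<Rightarrow> var \<Rightarrow> var \<Rightarrow> var \<Rightarrow> var \<Rightarrow> (var \<Rightarrow>\<^sub>0 nat) \<Rightarrow> bool" where
  "critical w p q r s m \<longleftrightarrow> distinct [p, q, r, s] \<and>
     lookup m p + lookup m q < w p q \<and> lookup m r + lookup m s < w r s \<and>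
     w p r \<le> lookup m p + lookup m r \<and> w p s \<le> lookup m p + lookup m s \<and>
     w q r \<le> lookup m q + lookup m r \<and> w q s \<le> lookup m q + lookup m s"

lemma exists_other_var: "\<exists>z. z \<noteq> x \<and> z \<noteq> y \<and> z \<noteq> (t::var)"
proof -
  have "card {x, y, t} \<le> 3" by (simp add: card_insert_if)
  then have "{x, y, t} \<noteq> UNIV" by (auto simp: UNIV_var)
  then show ?thesis by blast
qed

lemma var_distinct4:
  assumes "distinct [p, q, r, (s::var)]" shows "v \<in> {p, q, r, s}"
proof -
  have "card {p, q, r, s} = card (UNIV :: var set)" using assms by (simp add: UNIV_var)
  then have "{p, q, r, s} = UNIV" by (intro card_subset_eq) auto
  then show ?thesis by blast
qed

lemma not_meetsI: "x \<noteq> y \<Longrightarrow> lookup m x + lookup m y < w x y \<Longrightarrow> \<not> meets w m"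
  unfolding meets_def by (auto simp: not_le)

section \<open>Coefficients of cocycles outside the ideal\<close>

lemma cocycle_coeff_eq:
  fixes u :: "var \<Rightarrow> 'k::comm_ring_1 mpoly4"
  assumes u: "u \<in> cocycles (monomial_ideal P)" and "\<not> P (m + ev v + ev t)"
  shows "lookup (u v) (m + ev v) = lookup (u t) (m + ev t)"
proof -
  have "m + ev v + ev t \<notin> keys (X v * u t - X t * u v)"
    using assms unfolding cocycles_def monomial_ideal_def by blast
  then have "lookup (X v * u t) (m + ev v + ev t) = lookup (X t * u v) (m + ev v + ev t)"
    by (simp add: in_keys_iff lookup_minus)
  moreover have "lookup (X v * u t) (m + ev v + ev t) = lookup (u t) (m + ev t)"
    by (metis lookup_X_mult add.assoc add.commute)
  ultimately show ?thesis by simp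
qed

text \<open>A variable \<open>t\<close> off the violated pair and different from \<open>v\<close>
  keeps the exponent outside the ideal, where \<open>X t * u v\<close> must agree with
  \<open>X v * u t\<close>; the latter has no term without \<open>v\<close>.\<close>

lemma cocycle_boundary_coeff:
  fixes u :: "var \<Rightarrow> 'k::comm_ring_1 mpoly4" and m :: "var \<Rightarrow>\<^sub>0 nat"
  assumes u: "u \<in> cocycles (monomial_ideal (meets w))" and m: "\<not> meets w m" "lookup m v = 0"
  shows "lookup (u v) m = 0"
proof -
  obtain p q where pq: "p \<noteq> q" "lookup m p + lookup m q < w p q" using m(1) unfolding meets_def by (auto simp: not_le)
  obtain t where t: "t \<noteq> p" "t \<noteq> q" "t \<noteq> v" using exists_other_var by blast
  have "\<not> meets w (m + ev t)" using pq t by (intro not_meetsI[of p q]) (auto simp: lookup_add lookup_ev)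
  then have "m + ev t \<notin> keys (X t * u v - X v * u t)"
    using u unfolding cocycles_def monomial_ideal_def by blast
  then have "lookup (X t * u v) (m + ev t) = lookup (X v * u t) (m + ev t)"
    by (simp add: in_keys_iff lookup_minus)
  moreover have "lookup (X v * u t) (m + ev t) = 0"
    using m t by (intro lookup_X_mult_eq_0) (simp add: lookup_add lookup_ev)
  ultimately show ?thesis by simp
qed

lemma cocycle_consistent_or_critical:
  fixes u :: "var \<Rightarrow> 'k::comm_ring_1 mpoly4"
  assumes sym: "\<And>p q. w p q = w q p"
    and u: "u \<in> cocycles (monomial_ideal (meets w))"
    and v: "\<not> meets w (m + ev v)" and t: "\<not> meets w (m + ev t)"
    and neq: "lookup (u v) (m + ev v) \<noteq> lookup (u t) (m + ev t)"
  shows "\<exists>p q r s. critical w p q r s m"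
proof -
  define C where "C v = lookup (u v) (m + ev v)" for v
  have eq: "C x = C y" if "\<not> meets w (m + ev x + ev y)" for x y
    unfolding C_def using cocycle_coeff_eq[OF u that] .
  have edge: "C x = C y" if "p \<noteq> q" "lookup m p + lookup m q < w p q" "x \<notin> {p, q}" "y \<notin> {p, q}" for p q x y
    using that by (intro eq not_meetsI[of p q]) (auto simp: lookup_add lookup_ev)
  have Cvt: "C v \<noteq> C t" using neq by (simp add: C_def)
  then have vt: "v \<noteq> t" by blast
  \<comment> \<open>A pair violated at \<open>m + ev v\<close> contains \<open>t\<close> and not
    \<open>v\<close>, since otherwise it would identify \<open>C v\<close> with \<open>C t\<close>,
    directly or through a third variable. So it is already violated at \<open>m\<close>.\<close>
  have step: "\<exists>y. y \<noteq> v \<and> y \<noteq> t \<and> lookup m t + lookup m y < w t y"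
    if v: "\<not> meets w (m + ev v)" and Cvt: "C v \<noteq> C t" for v t
  proof -
    have vt: "v \<noteq> t" using Cvt by blast
    obtain p q where pq: "p \<noteq> q" "lookup (m + ev v) p + lookup (m + ev v) q < w p q"
      using v unfolding meets_def by (auto simp: not_le)
    have "t \<in> {p, q}"
    proof (rule ccontr)
      assume "t \<notin> {p, q}"
      then have "C v = C t" using pq by (intro eq not_meetsI[of p q]) (auto simp: lookup_add lookup_ev)
      with Cvt show False by blast
    qed
    moreover have "v \<notin> {p, q}"
    proof
      assume vpq: "v \<in> {p, q}"
      obtain z where z: "z \<noteq> p" "z \<noteq> q" "z \<noteq> v" using exists_other_var by blast
      have "C v = C z" using pq z by (intro eq not_meetsI[of p q]) (auto simp: lookup_add lookup_ev)
      moreover have "C t = C z" using pq z vpq \<open>t \<in> {p, q}\<close> vt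
        by (intro eq not_meetsI[of p q]) (auto simp: lookup_add lookup_ev)
      ultimately show False using Cvt by simp
    qed
    ultimately obtain y where "y \<noteq> v" "y \<noteq> t" "w p q = w t y" "lookup m p + lookup m q = lookup m t + lookup m y"
      "v \<noteq> p" "v \<noteq> q"
      using pq(1) sym by (auto simp: add.commute) (metis add.commute)+
    with pq show ?thesis by (intro exI[of _ y]) (auto simp: lookup_add lookup_ev)
  qed
  obtain x where x: "x \<noteq> v" "x \<noteq> t" "lookup m t + lookup m x < w t x" using step[OF v Cvt] by blast
  obtain y where y: "y \<noteq> v" "y \<noteq> t" "lookup m v + lookup m y < w v y" using step[OF t] Cvt by metis
  have xy: "x \<noteq> y"
  proof
    assume "x = y"
    obtain z where z: "z \<noteq> t" "z \<noteq> x" "z \<noteq> v" using exists_other_var by blast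
    have "C v = C z" using x z vt by (intro edge[of t x]) auto
    moreover have "C t = C z" using y z x vt \<open>x = y\<close> by (intro edge[of v y]) auto
    ultimately show False using Cvt by simp
  qed
  have Cvy: "C v = C y" using x y vt xy by (intro edge[of t x]) auto
  have Ctx: "C t = C x" using x y vt xy by (intro edge[of v y]) auto
  \<comment> \<open>Any third violated pair would identify a value on \<open>{v, y}\<close> with one
    on \<open>{t, x}\<close>.\<close>
  have "w t v \<le> lookup m t + lookup m v"
    using edge[of t v x y] x y vt xy Cvt Cvy Ctx by (metis empty_iff insert_iff not_le)
  moreover have "w t y \<le> lookup m t + lookup m y"
    using edge[of t y x v] x y vt xy Cvt Cvy Ctx by (metis empty_iff insert_iff not_le)
  moreover have "w x v \<le> lookup m x + lookup m v"
    using edge[of x v t y] x y vt xy Cvt Cvy Ctx by (metis empty_iff insert_iff not_le)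
  moreover have "w x y \<le> lookup m x + lookup m y"
    using edge[of x y t v] x y vt xy Cvt Cvy Ctx by (metis empty_iff insert_iff not_le)
  ultimately have "critical w t x v y m"
    unfolding critical_def using x y vt xy by auto
  then show ?thesis by blast
qed

lemma coboundary_if_consistent:
  fixes u :: "var \<Rightarrow> 'k::comm_ring_1 mpoly4"
  assumes u: "u \<in> cocycles (monomial_ideal (meets w))"
    and cons: "\<And>m v t. \<not> meets w (m + ev v) \<Longrightarrow> \<not> meets w (m + ev t) \<Longrightarrow>
      lookup (u v) (m + ev v) = lookup (u t) (m + ev t)"
  shows "u \<in> coboundaries (monomial_ideal (meets w))"
proof -
  \<comment> \<open>The coefficients of the sought \<open>r\<close>. By consistency the choice of
    \<open>v\<close> is immaterial, and \<open>0\<close> is taken where every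
    \<open>m + ev v\<close> lies in the ideal.\<close>
  define \<rho> where "\<rho> m = (if \<exists>v. \<not> meets w (m + ev v)
    then lookup (u (SOME v. \<not> meets w (m + ev v))) (m + ev (SOME v. \<not> meets w (m + ev v))) else 0)" for m
  have \<rho>: "\<rho> m = lookup (u v) (m + ev v)" if "\<not> meets w (m + ev v)" for m v
    unfolding \<rho>_def using cons[OF someI[of "\<lambda>v. \<not> meets w (m + ev v)", OF that] that] that by auto
  have "{m. \<rho> m \<noteq> 0} \<subseteq> (\<Union>v. (\<lambda>m. m + ev v) -` keys (u v))"
    unfolding \<rho>_def by (auto simp: in_keys_iff)
  moreover have "finite (\<Union>v. (\<lambda>m. m + ev v) -` keys (u v))"
    by (intro finite_UN_I finite_vimageI) (auto simp: inj_def)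
  ultimately have fin: "finite {m. \<rho> m \<noteq> 0}" by (rule finite_subset)
  define r where "r = Abs_poly_mapping \<rho>"
  have r: "lookup r = \<rho>" unfolding r_def using fin by simp
  have "meets w m" if "m \<in> keys (u v - X v * r)" for m v
  proof (rule ccontr)
    assume nm: "\<not> meets w m"
    show False
    proof (cases "lookup m v = 0")
      case True
      then have "lookup (u v - X v * r) m = 0"
        using cocycle_boundary_coeff[OF u nm True] lookup_X_mult_eq_0[OF True] by (simp add: lookup_minus)
      with that show False by (simp add: in_keys_iff)
    next
      case False
      define n where "n = m - ev v"
      have m: "m = n + ev v" using diff_ev_add[OF False] by (simp add: n_def)
      have "lookup (u v - X v * r) m = 0"
        unfolding m lookup_minus lookup_X_mult r using \<rho>[of n v] nm m by simp
      with that show False by (simp add: in_keys_iff)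
    qed
  qed
  then show ?thesis unfolding coboundaries_def monomial_ideal_def by blast
qed

lemma coboundary_if_not_critical:
  fixes u :: "var \<Rightarrow> 'k::comm_ring_1 mpoly4"
  assumes sym: "\<And>p q. w p q = w q p" and u: "u \<in> cocycles (monomial_ideal (meets w))"
    and "\<And>m v p q r s. critical w p q r s m \<Longrightarrow> lookup (u v) (m + ev v) = 0"
  shows "u \<in> coboundaries (monomial_ideal (meets w))"
proof (rule coboundary_if_consistent[OF u])
  fix m v t assume *: "\<not> meets w (m + ev v)" "\<not> meets w (m + ev t)"
  show "lookup (u v) (m + ev v) = lookup (u t) (m + ev t)"
    using cocycle_consistent_or_critical[OF sym u *] assms(3) by metis
qed

section \<open>The socle of the Rao module of a tetrahedral curve\<close>

text \<open>Gaussian elimination: a pivot \<open>A j e\<close> removes the unknown \<open>j\<close>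
  and the equation \<open>e\<close>. The enumeration \<open>s\<close> skips \<open>j\<close>, and
  \<open>c' j\<close> is recovered from that equation.\<close>

lemma homogeneous_system_solvable:
  fixes A :: "nat \<Rightarrow> 'e \<Rightarrow> 'k::field"
  assumes "finite E" "card E < n"
  shows "\<exists>c. (\<exists>i<n. c i \<noteq> 0) \<and> (\<forall>e\<in>E. (\<Sum>i<n. c i * A i e) = 0)"
  using assms
proof (induction E arbitrary: n A rule: finite_induct)
  case empty
  then show ?case by (intro exI[of _ "\<lambda>_. 1"]) auto
next
  case (insert e E)
  then obtain m where n: "n = Suc m" and m: "card E < m" by (cases n) auto
  show ?case
  proof (cases "\<forall>i<n. A i e = 0")
    case True
    from insert.IH[of n A] insert.prems insert.hyps obtain c where
      "\<exists>i<n. c i \<noteq> 0" "\<forall>e\<in>E. (\<Sum>i<n. c i * A i e) = 0" by auto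
    with True show ?thesis by (intro exI[of _ c]) auto
  next
    case False
    then obtain j where j: "j < n" "A j e \<noteq> 0" by blast
    define s where "s i = (if i < j then i else Suc i)" for i
    have s: "bij_betw s {..<m} ({..<n} - {j})"
      unfolding bij_betw_def
    proof
      show "inj_on s {..<m}" by (auto simp: inj_on_def s_def split: if_splits)
      show "s ` {..<m} = {..<n} - {j}"
      proof
        show "s ` {..<m} \<subseteq> {..<n} - {j}" using j n by (auto simp: s_def)
        show "{..<n} - {j} \<subseteq> s ` {..<m}"
        proof
          fix i assume i: "i \<in> {..<n} - {j}"
          then have "i = s (if i < j then i else i - 1)" "(if i < j then i else i - 1) < m"
            using j n by (auto simp: s_def)
          then show "i \<in> s ` {..<m}" by blast
        qed
      qed
    qed
    define B where "B i x = A (s i) x - A (s i) e / A j e * A j x" for i x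
    from insert.IH[OF m, of B] obtain c where c: "\<exists>i<m. c i \<noteq> 0"
      "\<forall>x\<in>E. (\<Sum>i<m. c i * B i x) = 0" by blast
    define c' where "c' i = (if i = j then - (\<Sum>l<m. c l * A (s l) e / A j e) else c (the_inv_into {..<m} s i))" for i
    have c's: "c' (s i) = c i" if "i < m" for i
    proof -
      have "s i \<noteq> j" by (simp add: s_def)
      moreover have "the_inv_into {..<m} s (s i) = i"
        using that bij_betw_imp_inj_on[OF s] by (intro the_inv_into_f_f) auto
      ultimately show ?thesis by (simp add: c'_def)
    qed
    have sum: "(\<Sum>i<n. c' i * A i x) = (\<Sum>i<m. c i * B i x)" for x
    proof -
      have "(\<Sum>i<n. c' i * A i x) = c' j * A j x + (\<Sum>i\<in>{..<n} - {j}. c' i * A i x)"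
        using j by (intro sum.remove) auto
      also have "(\<Sum>i\<in>{..<n} - {j}. c' i * A i x) = (\<Sum>i<m. c' (s i) * A (s i) x)"
        using sum.reindex_bij_betw[OF s, of "\<lambda>i. c' i * A i x"] by simp
      also have "\<dots> = (\<Sum>i<m. c i * A (s i) x)" by (intro sum.cong) (auto simp: c's)
      also have "c' j * A j x = - (\<Sum>i<m. c i * A (s i) e / A j e * A j x)"
        by (simp add: c'_def sum_distrib_right)
      finally show ?thesis
        by (simp add: B_def right_diff_distrib sum_subtractf mult.assoc)
    qed
    obtain i where i: "i < m" "c i \<noteq> 0" using c by blast
    then have "s i < n" "c' (s i) \<noteq> 0" using s c's by (auto simp: bij_betw_def)
    moreover have "(\<Sum>i<n. c' i * A i e) = 0" unfolding sum using j by (simp add: B_def)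
    ultimately show ?thesis using c sum by (intro exI[of _ c']) auto
  qed
qed

section \<open>Upper bound for the socle dimension\<close>

lemma cocycles_sum:
  assumes "is_ideal I" "\<And>i. i \<in> S \<Longrightarrow> U i \<in> cocycles I"
  shows "(\<lambda>v. \<Sum>i\<in>S. c i * U i v) \<in> cocycles I"
proof -
  have "X v * (\<Sum>i\<in>S. c i * U i t) - X t * (\<Sum>i\<in>S. c i * U i v) = (\<Sum>i\<in>S. c i * (X v * U i t - X t * U i v))" for v t
    by (simp add: sum_distrib_left sum_subtractf algebra_simps)
  moreover have "c i * (X v * U i t - X t * U i v) \<in> I" if "i \<in> S" for i v t
    using assms that unfolding cocycles_def is_ideal_def by blast
  then have "(\<Sum>i\<in>S. c i * (X v * U i t - X t * U i v)) \<in> I" for v t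
    by (intro is_ideal_sum[OF assms(1)])
  ultimately show ?thesis unfolding cocycles_def by simp
qed

lemma lookup_const_mult: "lookup (single 0 c * F) m = c * lookup F (m :: var \<Rightarrow>\<^sub>0 nat)" for c :: "'k::comm_ring_1"
  using lookup_single_mult[of 0 c F m] by simp

lemma finite_bounded_exponents: "finite {m :: var \<Rightarrow>\<^sub>0 nat. \<forall>v. lookup m v < D}"
proof (rule finite_imageD)
  have "finite {f :: var \<Rightarrow> nat. \<forall>v. f v \<in> {..<D}}"
    using finite_set_of_finite_funs[of "UNIV :: var set" "{..<D}"] by simp
  then show "finite (lookup ` {m :: var \<Rightarrow>\<^sub>0 nat. \<forall>v. lookup m v < D})"
    by (rule finite_subset[rotated]) auto
  show "inj_on lookup {m :: var \<Rightarrow>\<^sub>0 nat. \<forall>v. lookup m v < D}"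
    by (rule inj_onI) (metis poly_mapping_eqI)
qed

lemma critical_bounded:
  assumes "critical w p q r s m" "\<And>p q. w p q \<le> D" shows "lookup m v < D"
proof -
  have "v \<in> {p, q, r, s}" using assms(1) by (intro var_distinct4) (simp add: critical_def)
  then show ?thesis using assms(1) assms(2)[of p q] assms(2)[of r s] unfolding critical_def by auto
qed

text \<open>Critical exponents lie in a finite box. With more cocycles than there are pairs of an
  exponent in the box and a variable, some nontrivial combination vanishes at all critical positions
  and is a coboundary.\<close>

lemma ext_dim_bounded:
  fixes w :: "var \<Rightarrow> var \<Rightarrow> nat"
  assumes sym: "\<And>p q. w p q = w q p"
  shows "\<exists>N. \<forall>n. ext_dim_ge n (monomial_ideal (meets w) :: 'k::field mpoly4 set) \<longrightarrow> n \<le> N"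
proof -
  define D where "D = Max (range (\<lambda>(p, q). w p q))"
  have D: "w p q \<le> D" for p q unfolding D_def by (intro Max_ge) auto
  define E where "E = {m :: var \<Rightarrow>\<^sub>0 nat. \<forall>v. lookup m v < D} \<times> (UNIV :: var set)"
  have fin: "finite E" unfolding E_def using finite_bounded_exponents by simp
  let ?I = "monomial_ideal (meets w) :: 'k mpoly4 set"
  have "n \<le> card E" if dim: "ext_dim_ge n ?I" for n
  proof (rule ccontr)
    assume "\<not> n \<le> card E"
    then have n: "card E < n" by simp
    obtain U where U: "\<And>i. i < n \<Longrightarrow> U i \<in> cocycles ?I"
      and ind: "\<And>c. (\<lambda>v. \<Sum>i<n. single 0 (c i) * U i v) \<in> coboundaries ?I \<Longrightarrow> \<forall>i<n. c i = 0"
      using dim unfolding ext_dim_ge_def by blast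
    obtain c where c: "\<exists>i<n. c i \<noteq> 0"
      "\<forall>e\<in>E. (\<Sum>i<n. c i * lookup (U i (snd e)) (fst e + ev (snd e))) = 0"
      using homogeneous_system_solvable[OF fin n, of "\<lambda>i e. lookup (U i (snd e)) (fst e + ev (snd e))"] by blast
    have "(\<lambda>v. \<Sum>i<n. single 0 (c i) * U i v) \<in> coboundaries ?I"
    proof (rule coboundary_if_not_critical[OF sym])
      show "(\<lambda>v. \<Sum>i<n. single 0 (c i) * U i v) \<in> cocycles ?I"
        using U by (intro cocycles_sum is_ideal_meets) auto
      fix m v p q r s assume "critical w p q r s m"
      then have "(m, v) \<in> E" unfolding E_def using critical_bounded D by blast
      then show "lookup (\<Sum>i<n. single 0 (c i) * U i v) (m + ev v) = 0"
        using bspec[OF c(2), of "(m, v)"] by (simp add: lookup_sum lookup_const_mult)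
    qed
    with ind c(1) show False by blast
  qed
  then show ?thesis by blast
qed

text \<open>Both opposite lines are missed by exactly one, so multiplying by any variable meets one
  of them. These exponents give the socle.\<close>

definition max_critical :: "(var \<Rightarrow> var \<Rightarrow> nat) \<Rightarrow> var \<Rightarrow> var \<Rightarrow> var \<Rightarrow> var \<Rightarrow> (var \<Rightarrow>\<^sub>0 nat) \<Rightarrow> bool" where
  "max_critical w p q r s m \<longleftrightarrow> critical w p q r s m \<and>
     Suc (lookup m p + lookup m q) = w p q \<and> Suc (lookup m r + lookup m s) = w r s"

text \<open>The indicator function of the component \<open>{p, q}\<close> of the disconnected degree
  complex, placed in degree \<open>m\<close>.\<close>

definition critical_cocycle :: "var \<Rightarrow> var \<Rightarrow> (var \<Rightarrow>\<^sub>0 nat) \<Rightarrow> var \<Rightarrow> 'k::comm_ring_1 mpoly4" where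
  "critical_cocycle p q m v = (if v \<in> {p, q} then single (m + ev v) 1 else 0)"

lemma max_critical_meets:
  assumes sym: "\<And>p q. w p q = w q p" and m: "max_critical w p q r s m"
    and x: "x \<in> {p, q}" and y: "y \<notin> {p, q}"
  shows "meets w (m + ev x + ev y)"
proof -
  have d: "distinct [p, q, r, s]" using m by (simp add: max_critical_def critical_def)
  have y': "y \<in> {r, s}" using var_distinct4[OF d, of y] y by auto
  have "w a b \<le> lookup (m + ev x + ev y) a + lookup (m + ev x + ev y) b" if ab: "a \<noteq> b" for a b
  proof -
    have "a \<in> {p, q, r, s}" "b \<in> {p, q, r, s}" using var_distinct4[OF d] by blast+
    then show ?thesis
      using m x y' d ab sym[of q p] sym[of s r] sym[of r p] sym[of s p] sym[of r q] sym[of s q]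
      unfolding max_critical_def critical_def by (auto simp: lookup_add lookup_ev)
  qed
  then show ?thesis unfolding meets_def by blast
qed

lemma critical_cocycle_in:
  assumes sym: "\<And>p q. w p q = w q p" and m: "max_critical w p q r s m"
  shows "(critical_cocycle p q m :: var \<Rightarrow> 'k::comm_ring_1 mpoly4) \<in> cocycles (monomial_ideal (meets w))"
proof -
  have "X v * critical_cocycle p q m t - X t * critical_cocycle p q m v \<in> (monomial_ideal (meets w) :: 'k mpoly4 set)" for v t
  proof -
    consider "v \<in> {p, q}" "t \<in> {p, q}" | "v \<in> {p, q}" "t \<notin> {p, q}" | "v \<notin> {p, q}" "t \<in> {p, q}" | "v \<notin> {p, q}" "t \<notin> {p, q}"
      by blast
    then show ?thesis
    proof cases
      case 1
      then have "X v * critical_cocycle p q m t - X t * critical_cocycle p q m v = (0 :: 'k mpoly4)"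
        by (simp add: critical_cocycle_def X_mult_single ac_simps)
      then show ?thesis by (simp add: monomial_ideal_def)
    next
      case 2
      then have "X v * critical_cocycle p q m t - X t * critical_cocycle p q m v = - (single (m + ev v + ev t) 1 :: 'k mpoly4)"
        by (simp add: critical_cocycle_def X_mult_single)
      then show ?thesis using max_critical_meets[OF sym m 2] by (simp add: monomial_ideal_def in_keys_iff lookup_single when_def)
    next
      case 3
      then have "X v * critical_cocycle p q m t - X t * critical_cocycle p q m v = (single (m + ev t + ev v) 1 :: 'k mpoly4)"
        by (simp add: critical_cocycle_def X_mult_single)
      then show ?thesis using max_critical_meets[OF sym m 3(2,1)] by (simp add: monomial_ideal_def)
    next
      case 4
      then show ?thesis by (auto simp: critical_cocycle_def monomial_ideal_def)
    qed
  qed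
  then show ?thesis unfolding cocycles_def by blast
qed

text \<open>If a combination were a coboundary of some \<open>\<rho>\<close>, comparing coefficients
  at \<open>h j + ev p\<close> and \<open>h j + ev r\<close>, both outside the ideal, would make the
  coefficient of \<open>\<rho>\<close> at \<open>h j\<close> equal to \<open>c j\<close> and to
  \<open>0\<close>.\<close>

lemma ext_dim_ge_critical:
  assumes sym: "\<And>p q. w p q = w q p" and fin: "finite T"
    and T: "\<And>m. m \<in> T \<Longrightarrow> max_critical w p q r s m"
  shows "ext_dim_ge (card T) (monomial_ideal (meets w) :: 'k::field mpoly4 set)"
proof -
  let ?n = "card T" and ?I = "monomial_ideal (meets w) :: 'k mpoly4 set"
  obtain h where h: "bij_betw h {..<?n} T" using ex_bij_betw_nat_finite[OF fin] by (auto simp: atLeast0LessThan)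
  have hT: "max_critical w p q r s (h i)" if "i < ?n" for i using h that T by (auto simp: bij_betw_def)
  have inj: "h i = h j \<longleftrightarrow> i = j" if "i < ?n" "j < ?n" for i j
    using h that by (auto simp: bij_betw_def inj_on_def)
  have "c j = 0" if cb: "(\<lambda>v. \<Sum>i<?n. single 0 (c i) * critical_cocycle p q (h i) v) \<in> coboundaries ?I" and j: "j < ?n" for c j
  proof -
    obtain \<rho> where \<rho>: "\<And>v. (\<Sum>i<?n. single 0 (c i) * critical_cocycle p q (h i) v) - X v * \<rho> \<in> ?I"
      using cb unfolding coboundaries_def by blast
    have crit: "critical w p q r s (h j)" using hT[OF j] by (simp add: max_critical_def)
    then have d: "p \<noteq> q" "r \<noteq> s" "r \<noteq> p" "r \<noteq> q" "s \<noteq> p" "s \<noteq> q" by (auto simp: critical_def)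
    have "\<not> meets w (h j + ev p)" using crit d
      by (intro not_meetsI[of r s]) (auto simp: lookup_add lookup_ev critical_def)
    then have "h j + ev p \<notin> keys ((\<Sum>i<?n. single 0 (c i) * critical_cocycle p q (h i) p) - X p * \<rho>)"
      using \<rho>[of p] unfolding monomial_ideal_def by blast
    then have "(\<Sum>i<?n. c i * lookup (critical_cocycle p q (h i) p) (h j + ev p)) = lookup \<rho> (h j)"
      by (simp add: in_keys_iff lookup_minus lookup_sum lookup_const_mult)
    moreover have "(\<Sum>i<?n. c i * lookup (critical_cocycle p q (h i) p) (h j + ev p)) = (\<Sum>i<?n. if i = j then c i else 0)"
      by (intro sum.cong refl) (use inj j in \<open>auto simp: critical_cocycle_def lookup_single when_def\<close>)
    ultimately have 1: "c j = lookup \<rho> (h j)" using j by simp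
    have "\<not> meets w (h j + ev r)" using crit d
      by (intro not_meetsI[of p q]) (auto simp: lookup_add lookup_ev critical_def)
    then have "h j + ev r \<notin> keys ((\<Sum>i<?n. single 0 (c i) * critical_cocycle p q (h i) r) - X r * \<rho>)"
      using \<rho>[of r] unfolding monomial_ideal_def by blast
    then have "lookup \<rho> (h j) = 0"
      using d by (simp add: in_keys_iff lookup_minus critical_cocycle_def)
    with 1 show ?thesis by simp
  qed
  then show ?thesis unfolding ext_dim_ge_def
    using critical_cocycle_in[OF sym hT] by (intro exI[of _ "\<lambda>i. critical_cocycle p q (h i)"]) blast
qed

lemma exists_critical:
  assumes sym: "\<And>p q. w p q = w q p"
    and dim: "ext_dim_ge 1 (monomial_ideal (meets w) :: 'k::field mpoly4 set)"
  shows "\<exists>p q r s m. max_critical w p q r s m"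
proof -
  let ?I = "monomial_ideal (meets w) :: 'k mpoly4 set"
  obtain U where U: "U 0 \<in> cocycles ?I"
    and ind: "\<forall>c. (\<lambda>v. single 0 (c 0) * U 0 v) \<in> coboundaries ?I \<longrightarrow> c (0::nat) = 0"
    using dim unfolding ext_dim_ge_def by auto
  have "U 0 \<notin> coboundaries ?I" using spec[OF ind, of "\<lambda>_. 1"] by auto
  then obtain p q r s m where cr: "critical w p q r s m" using coboundary_if_not_critical[OF sym U] by blast
  \<comment> \<open>Raising the \<open>p\<close>- and \<open>r\<close>-entries until both opposite
    lines are missed by one keeps the other four lines met.\<close>
  define m' where "m' = m + single p (w p q - 1 - lookup m p - lookup m q) + single r (w r s - 1 - lookup m r - lookup m s)"
  have d: "distinct [p, q, r, s]" using cr by (simp add: critical_def)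
  have "lookup m' p = lookup m p + (w p q - 1 - lookup m p - lookup m q)" "lookup m' q = lookup m q"
    "lookup m' r = lookup m r + (w r s - 1 - lookup m r - lookup m s)" "lookup m' s = lookup m s"
    using d by (auto simp: m'_def lookup_add lookup_single when_def)
  then have "max_critical w p q r s m'" using cr unfolding max_critical_def critical_def by auto
  then show ?thesis by blast
qed

text \<open>The inequalities ensure that no lower bound for the \<open>r\<close>-entry exceeds an upper one.\<close>

lemma exists_max_critical_with_entry:
  assumes m: "max_critical w p q r s m"
    and ineq: "w p r + w p s \<le> w r s" "w q r + w q s \<le> w r s"
    and P: "0 < P" "Suc P < w p q"
  shows "\<exists>m'. max_critical w p q r s m' \<and> lookup m' p = P"
proof -
  have d: "distinct [p, q, r, s]" and cr: "critical w p q r s m" using m by (simp_all add: max_critical_def critical_def)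
  \<comment> \<open>The least \<open>r\<close>-entry that meets the lines \<open>pr\<close> and
    \<open>qr\<close> when the \<open>p\<close>-entry is \<open>P\<close> and the
    \<open>q\<close>-entry is \<open>w p q - 1 - P\<close>.\<close>
  define R where "R = Max {0, w p r - P, w q r - (w p q - 1 - P)}"
  have R: "w p r - P \<le> R" "w q r - (w p q - 1 - P) \<le> R"
    "R = 0 \<or> R = w p r - P \<or> R = w q r - (w p q - 1 - P)"
    by (auto simp: R_def max_def)
  define m' where "m' = single p P + single q (w p q - 1 - P) + single r R + single s (w r s - 1 - R)"
  have l: "lookup m' p = P" "lookup m' q = w p q - 1 - P" "lookup m' r = R" "lookup m' s = w r s - 1 - R"
    using d by (auto simp: m'_def lookup_add lookup_single when_def)
  \<comment> \<open>Two disjoint lines met by \<open>m\<close> have total weight at most its degree,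
    which is \<open>w p q + w r s - 2\<close>.\<close>
  have sums: "w p r + w q s + 2 \<le> w p q + w r s" "w p s + w q r + 2 \<le> w p q + w r s" "0 < w r s"
    using m unfolding max_critical_def critical_def by linarith+
  have "R < w r s" using R(3) sums ineq P by linarith
  moreover have "w p s + R + 1 \<le> w r s + P" "w q s + R + 2 + P \<le> w p q + w r s"
    using R(3) sums ineq P by linarith+
  ultimately have "max_critical w p q r s m'"
    unfolding max_critical_def critical_def l using d R P sums by (auto; linarith)
  with l show ?thesis by blast
qed

text \<open>Each \<open>p\<close>-entry strictly between \<open>0\<close> and
  \<open>w p q - 1\<close> occurs in a maximal critical exponent. The endpoints are left out because
  there the required \<open>r\<close>-entry could reach \<open>w r s\<close>.\<close>

lemma ext_dim_ge_weight:
  assumes sym: "\<And>p q. w p q = w q p" and m: "max_critical w p q r s m"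
    and ineq: "w p r + w p s \<le> w r s" "w q r + w q s \<le> w r s"
  shows "ext_dim_ge (w p q - 2) (monomial_ideal (meets w) :: 'k::field mpoly4 set)"
proof -
  have "\<forall>P\<in>{0<..<w p q - 1}. \<exists>m'. max_critical w p q r s m' \<and> lookup m' p = P"
    using exists_max_critical_with_entry[OF m ineq] by auto
  then obtain h where h: "\<And>P. P \<in> {0<..<w p q - 1} \<Longrightarrow> max_critical w p q r s (h P) \<and> lookup (h P) p = P" by metis
  have "inj_on h {0<..<w p q - 1}" by (rule inj_onI) (metis h)
  then have "card (h ` {0<..<w p q - 1}) = w p q - 2" by (simp add: card_image)
  moreover have "ext_dim_ge (card (h ` {0<..<w p q - 1})) (monomial_ideal (meets w) :: 'k mpoly4 set)"
    using h by (intro ext_dim_ge_critical[OF sym, where p=p and q=q and r=r and s=s]) auto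
  ultimately show ?thesis by simp
qed

section \<open>Arithmetically Cohen--Macaulay tetrahedral curves\<close>

lemma mon_deg_sum: "mon_deg m = (\<Sum>v\<in>UNIV. lookup m v)"
  unfolding mon_deg_def by (rule sum.mono_neutral_left) (auto simp: in_keys_iff)

lemma mon_deg_add: "mon_deg (m + n) = mon_deg m + mon_deg n"
  by (simp add: mon_deg_sum lookup_add sum.distrib)

lemma mon_deg_ev: "mon_deg (ev v) = 1"
  by (simp add: mon_deg_sum lookup_ev)

lemma homogeneous_add: "homogeneous d F \<Longrightarrow> homogeneous d G \<Longrightarrow> homogeneous d (F + G)"
  unfolding homogeneous_def using Poly_Mapping.keys_add[of F G] by blast

lemma homogeneous_mult: "homogeneous d F \<Longrightarrow> homogeneous e G \<Longrightarrow> homogeneous (d + e) (F * G)"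
  unfolding homogeneous_def using keys_mult[of F G] by (auto simp: mon_deg_add dest!: subsetD)

lemma homogeneous_X: "homogeneous 1 (X v)"
  by (auto simp: homogeneous_def X_ev mon_deg_ev split: if_splits)

lemma meets_saturated:
  fixes z :: "'k::comm_ring_1 mpoly4"
  assumes "\<And>v. X v * z \<in> monomial_ideal (meets w)"
  shows "z \<in> monomial_ideal (meets w)"
proof -
  have "meets w m" if m: "m \<in> keys z" for m
  proof (rule ccontr)
    assume "\<not> meets w m"
    then obtain p q where pq: "p \<noteq> q" "lookup m p + lookup m q < w p q" unfolding meets_def by (auto simp: not_le)
    obtain t where t: "t \<noteq> p" "t \<noteq> q" using exists_other_var by blast
    have "\<not> meets w (m + ev t)" using pq t by (intro not_meetsI[of p q]) (auto simp: lookup_add lookup_ev)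
    moreover have "m + ev t \<in> keys (X t * z)" using m by (simp add: keys_X_mult)
    ultimately show False using assms unfolding monomial_ideal_def by blast
  qed
  then show ?thesis unfolding monomial_ideal_def by blast
qed

section \<open>Elementary symmetric polynomials as a regular sequence\<close>

definition e1 :: "'k::comm_ring_1 mpoly4" where
  "e1 = (\<Sum>v\<in>UNIV. X v)"

definition e2 :: "'k::comm_ring_1 mpoly4" where
  "e2 = X Va * X Vb + X Va * X Vc + X Va * X Vd + X Vb * X Vc + X Vb * X Vd + X Vc * X Vd"

definition e3 :: "'k::comm_ring_1 mpoly4" where
  "e3 = X Va * X Vb * X Vc + X Va * X Vb * X Vd + X Va * X Vc * X Vd + X Vb * X Vc * X Vd"

definition e4 :: "'k::comm_ring_1 mpoly4" where
  "e4 = X Va * X Vb * X Vc * X Vd"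

lemma e1_expand: "e1 = X Va + X Vb + X Vc + X Vd"
  by (simp add: e1_def UNIV_var)

lemma finite_arg_max:
  fixes f :: "'a \<Rightarrow> nat"
  assumes "finite S" "S \<noteq> {}" shows "\<exists>x\<in>S. \<forall>y\<in>S. f y \<le> f x"
proof -
  have "Max (f ` S) \<in> f ` S" using assms by (intro Max_in) auto
  then obtain x where "x \<in> S" "Max (f ` S) = f x" by blast
  moreover have "f y \<le> Max (f ` S)" if "y \<in> S" for y using assms(1) that by (intro Max_ge) auto
  ultimately show ?thesis by auto
qed

lemma finite_arg_min:
  fixes f :: "'a \<Rightarrow> nat"
  assumes "S \<noteq> {}" shows "\<exists>x\<in>S. \<forall>y\<in>S. f x \<le> f y"
  using assms ex_has_least_nat[of "\<lambda>x. x \<in> S" _ f] by blast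

text \<open>Modulo \<open>(x\<^sub>p, x\<^sub>q)\<^sup>n\<close>, the leading term of \<open>h\<close> is taken with the least degree in \<open>x\<^sub>p, x\<^sub>q\<close>
  and then the largest exponent of a third variable \<open>x\<^sub>r\<close>; multiplication by \<open>e1\<close> multiplies it by \<open>x\<^sub>r\<close>.\<close>

lemma e1_regular:
  fixes h :: "'k::comm_ring_1 mpoly4"
  assumes "e1 * h \<in> monomial_ideal (meets w)"
  shows "h \<in> monomial_ideal (meets w)"
proof (rule ccontr)
  assume "h \<notin> monomial_ideal (meets w)"
  then obtain n where n: "n \<in> keys h" "\<not> meets w n" unfolding monomial_ideal_def by blast
  then obtain p q where pq: "p \<noteq> q" "lookup n p + lookup n q < w p q" unfolding meets_def by (auto simp: not_le)
  obtain r where r: "r \<noteq> p" "r \<noteq> q" using exists_other_var by blast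
  define D where "D m = lookup m p + lookup m q" for m :: "var \<Rightarrow>\<^sub>0 nat"
  obtain m0 where m0: "m0 \<in> keys h" "\<And>m'. m' \<in> keys h \<Longrightarrow> D m0 \<le> D m'"
    using finite_arg_min[of "keys h" D] n(1) by blast
  obtain m where m: "m \<in> keys h" "D m = D m0"
    and max: "\<And>m'. m' \<in> keys h \<Longrightarrow> D m' = D m0 \<Longrightarrow> lookup m' r \<le> lookup m r"
    using finite_arg_max[of "{m \<in> keys h. D m = D m0}" "\<lambda>m. lookup m r"] m0 by auto
  have min: "D m \<le> D m'" if "m' \<in> keys h" for m' using m0 m that by simp
  have "lookup (X v * h) (m + ev r) = 0" if v: "v \<noteq> r" for v
  proof (rule ccontr)
    assume "lookup (X v * h) (m + ev r) \<noteq> 0"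
    then have "m + ev r \<in> keys (X v * h)" by (simp add: in_keys_iff)
    then obtain k where k: "k \<in> keys h" "m + ev r = k + ev v" by (auto simp: keys_X_mult)
    have l: "lookup m x + lookup (ev r) x = lookup k x + lookup (ev v) x" for x
      using arg_cong[OF k(2), of "\<lambda>m. lookup m x"] by (simp add: lookup_add)
    show False
    proof (cases "v \<in> {p, q}")
      case True
      then have "D k < D m" using l[of p] l[of q] pq(1) r v by (auto simp: D_def lookup_ev)
      with min[OF k(1)] show False by simp
    next
      case False
      then have "D k = D m" using l[of p] l[of q] r v by (auto simp: D_def lookup_ev)
      moreover have "lookup k r = Suc (lookup m r)" using l[of r] v by (simp add: lookup_ev)
      ultimately show False using max[OF k(1)] m by simp
    qed
  qed
  then have "lookup (e1 * h) (m + ev r) = lookup (X r * h) (m + ev r)"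
    unfolding e1_def sum_distrib_right lookup_sum by (subst sum.remove[of _ r]) auto
  also have "\<dots> \<noteq> 0" using m(1) by (simp add: in_keys_iff)
  finally have "m + ev r \<in> keys (e1 * h)" by (simp add: in_keys_iff)
  moreover have "D m < w p q" using min[OF n(1)] pq by (simp add: D_def)
  then have "\<not> meets w (m + ev r)" using pq r by (intro not_meetsI[of p q]) (auto simp: D_def lookup_add lookup_ev)
  ultimately show False using assms unfolding monomial_ideal_def by blast
qed

lemma ideal_gen_insert:
  fixes f :: "'r::comm_ring_1"
  assumes I: "is_ideal I" shows "ideal_gen (insert f I) = {i + f * y | i y. i \<in> I}" (is "_ = ?S")
proof
  have z: "0 \<in> I" and a: "\<And>x y. x \<in> I \<Longrightarrow> y \<in> I \<Longrightarrow> x + y \<in> I" and mu: "\<And>r x. x \<in> I \<Longrightarrow> r * x \<in> I"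
    using I unfolding is_ideal_def by blast+
  have "is_ideal ?S"
    unfolding is_ideal_def
  proof (intro conjI ballI allI)
    have "0 = 0 + f * 0" by simp
    with z show "0 \<in> ?S" by blast
  next
    fix x y assume "x \<in> ?S" "y \<in> ?S"
    then obtain i s j t where "x = i + f * s" "y = j + f * t" "i \<in> I" "j \<in> I" by blast
    moreover from this have "x + y = (i + j) + f * (s + t)" by (simp add: algebra_simps)
    ultimately show "x + y \<in> ?S" using a by blast
  next
    fix r x assume "x \<in> ?S"
    then obtain i s where "x = i + f * s" "i \<in> I" by blast
    moreover from this have "r * x = r * i + f * (r * s)" by (simp add: algebra_simps)
    ultimately show "r * x \<in> ?S" using mu by blast
  qed
  moreover have "insert f I \<subseteq> ?S"
  proof
    fix x assume "x \<in> insert f I"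
    then have "x = 0 + f * 1 \<or> (x = x + f * 0 \<and> x \<in> I)" by auto
    with z show "x \<in> ?S" by blast
  qed
  ultimately show "ideal_gen (insert f I) \<subseteq> ?S" by (rule ideal_gen_least)
  show "?S \<subseteq> ideal_gen (insert f I)"
  proof
    fix x assume "x \<in> ?S"
    then obtain i y where x: "x = i + y * f" "i \<in> I" by (auto simp: mult.commute)
    have "i \<in> ideal_gen (insert f I)" "f \<in> ideal_gen (insert f I)"
      using x(2) ideal_gen_superset[of "insert f I"] by blast+
    then show "x \<in> ideal_gen (insert f I)"
      using is_ideal_ideal_gen[of "insert f I"] unfolding x(1) is_ideal_def by blast
  qed
qed

text \<open>Writing \<open>X v * z = i v + e1 * u v\<close>, regularity of \<open>e1\<close> makes
  \<open>u\<close> a cocycle: this is the connecting map from Hom(k, R/(I, e1)) to Ext^1(k, R/I). If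
  \<open>u\<close> comes from \<open>r\<close>, then \<open>z - e1 * r\<close> lies in
  \<open>I\<close> by saturation.\<close>

lemma socle_mod_e1:
  fixes z :: "'k::field mpoly4" and w :: "var \<Rightarrow> var \<Rightarrow> nat"
  defines "I \<equiv> monomial_ideal (meets w)"
  assumes cob: "cocycles I \<subseteq> coboundaries I"
    and z: "\<And>v. X v * z \<in> ideal_gen (insert e1 I)"
  shows "z \<in> ideal_gen (insert e1 I)"
proof -
  have I: "is_ideal I" unfolding I_def by (rule is_ideal_meets)
  have mu: "\<And>r x. x \<in> I \<Longrightarrow> r * x \<in> I" and ad: "\<And>x y. x \<in> I \<Longrightarrow> y \<in> I \<Longrightarrow> x + y \<in> I"
    using I unfolding is_ideal_def by blast+
  note J = ideal_gen_insert[OF I, of e1]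
  have "\<forall>v. \<exists>i y. X v * z = i + e1 * y \<and> i \<in> I" using z unfolding J by blast
  then obtain i u where iu: "\<And>v. X v * z = i v + e1 * u v" "\<And>v. i v \<in> I" by metis
  have "X v * u t - X t * u v \<in> I" for v t
  proof -
    have "e1 * (X v * u t - X t * u v) = X t * i v - X v * i t" using iu(1)[of v] iu(1)[of t] by algebra
    moreover have "X t * i v - X v * i t \<in> I"
      by (intro is_ideal_diff[OF I] mu iu(2))
    ultimately have "e1 * (X v * u t - X t * u v) \<in> I" by (simp only:)
    then show ?thesis unfolding I_def by (rule e1_regular)
  qed
  then have "u \<in> coboundaries I" using cob unfolding cocycles_def by blast
  then obtain r where r: "\<And>v. u v - X v * r \<in> I" unfolding coboundaries_def by blast
  have "X v * (z - e1 * r) \<in> I" for v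
  proof -
    have "X v * (z - e1 * r) = i v + e1 * (u v - X v * r)" using iu(1)[of v] by algebra
    then show ?thesis using ad[OF iu(2) mu[OF r]] by (simp only:)
  qed
  then have "z - e1 * r \<in> I" unfolding I_def by (rule meets_saturated)
  moreover have "z = (z - e1 * r) + e1 * r" by simp
  ultimately show ?thesis unfolding J by blast
qed

lemma quartic_root:
  fixes x a b c d :: "'r::comm_ring_1"
  assumes "x \<in> {a, b, c, d}"
  shows "x ^ 4 = (a * b * c + a * b * d + a * c * d + b * c * d) * x - a * b * c * d
    + x ^ 3 * (a + b + c + d) - x ^ 2 * (a * b + a * c + a * d + b * c + b * d + c * d)"
proof -
  have "(x - a) * (x - b) * (x - c) * (x - d) = 0" using assms by auto
  then show ?thesis by (simp add: algebra_simps eval_nat_numeral)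
qed

text \<open>Descending induction on the degree of a monomial multiplier of \<open>z\<close>: from
  degree \<open>4 * N\<close> on, some variable occurs to the power \<open>N\<close>, and below that
  saturation removes one variable at a time.\<close>

lemma saturated_power:
  fixes z :: "'k::comm_ring_1 mpoly4"
  assumes J: "is_ideal J" and sat: "\<And>y. (\<And>v. X v * y \<in> J) \<Longrightarrow> y \<in> J"
    and z: "\<And>v. X v ^ N * z \<in> J"
  shows "z \<in> J"
proof -
  have "X Va ^ i * X Vb ^ j * X Vc ^ k * X Vd ^ l * z \<in> J" for i j k l
  proof (induction "4 * N - (i + j + k + l)" arbitrary: i j k l rule: less_induct)
    case less
    have mu: "\<And>r x. x \<in> J \<Longrightarrow> r * x \<in> J" using J unfolding is_ideal_def by blast
    have pw: "X v ^ n * z \<in> J" if "N \<le> n" for v n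
    proof -
      have "X v ^ n * z = X v ^ (n - N) * (X v ^ N * z)" using that
        by (simp flip: mult.assoc power_add)
      then show ?thesis using mu z by simp
    qed
    consider "N \<le> i" | "N \<le> j" | "N \<le> k" | "N \<le> l" | "i + j + k + l < 4 * N" by linarith
    then show ?case
    proof cases
      case 1 then show ?thesis using mu[OF pw[of i Va], of "X Vb ^ j * X Vc ^ k * X Vd ^ l"] by (simp add: mult_ac)
    next
      case 2 then show ?thesis using mu[OF pw[of j Vb], of "X Va ^ i * X Vc ^ k * X Vd ^ l"] by (simp add: mult_ac)
    next
      case 3 then show ?thesis using mu[OF pw[of k Vc], of "X Va ^ i * X Vb ^ j * X Vd ^ l"] by (simp add: mult_ac)
    next
      case 4 then show ?thesis using mu[OF pw[of l Vd], of "X Va ^ i * X Vb ^ j * X Vc ^ k"] by (simp add: mult_ac)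
    next
      case 5
      have "X v * (X Va ^ i * X Vb ^ j * X Vc ^ k * X Vd ^ l * z) \<in> J" for v
      proof (cases v)
        case Va then show ?thesis using less[of "Suc i" j k l] 5 by (simp add: mult_ac)
      next
        case Vb then show ?thesis using less[of i "Suc j" k l] 5 by (simp add: mult_ac)
      next
        case Vc then show ?thesis using less[of i j "Suc k" l] 5 by (simp add: mult_ac)
      next
        case Vd then show ?thesis using less[of i j k "Suc l"] 5 by (simp add: mult_ac)
      qed
      then show ?thesis by (rule sat)
    qed
  qed
  from this[of 0 0 0 0] show ?thesis by simp
qed

text \<open>Every monomial of \<open>e3\<close> and \<open>e4\<close> omits at most one variable, so
  it meets each of the six lines.\<close>

lemma triple_products_power:
  "(e3 * X v - e4) ^ n \<in> (monomial_ideal (\<lambda>m. \<forall>p q. p \<noteq> q \<longrightarrow> n \<le> lookup m p + lookup m q) :: 'k::comm_ring_1 mpoly4 set)"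
proof (induction n)
  case 0 then show ?case by (simp add: monomial_ideal_def)
next
  case (Suc n)
  let ?T = "monomial_ideal (\<lambda>m. \<forall>p q. p \<noteq> q \<longrightarrow> 1 \<le> lookup m p + lookup m q) :: 'k mpoly4 set"
  have T: "is_ideal ?T" by (rule is_ideal_monomial_ideal) (fastforce simp: lookup_add)
  then have mu: "\<And>r x. x \<in> ?T \<Longrightarrow> x * r \<in> ?T" and ad: "\<And>x y. x \<in> ?T \<Longrightarrow> y \<in> ?T \<Longrightarrow> x + y \<in> ?T"
    unfolding is_ideal_def by (auto simp: mult.commute)
  have "X Va * X Vb * X Vc \<in> ?T" "X Va * X Vb * X Vd \<in> ?T" "X Va * X Vc * X Vd \<in> ?T" "X Vb * X Vc * X Vd \<in> ?T"
    by (auto simp: X_ev mult_single monomial_ideal_def all_var lookup_add lookup_ev)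
  then have "e3 \<in> ?T" "e4 \<in> ?T" unfolding e3_def e4_def by (blast intro: ad mu)+
  then have "e3 * X v - e4 \<in> ?T" by (intro is_ideal_diff[OF T] mu)
  then have k: "1 \<le> lookup m p + lookup m q" if "m \<in> keys (e3 * X v - e4 :: 'k mpoly4)" "p \<noteq> q" for m p q
    using that unfolding monomial_ideal_def by blast
  have "Suc n \<le> lookup m p + lookup m q" if m: "m \<in> keys ((e3 * X v - e4) ^ Suc n :: 'k mpoly4)" and "p \<noteq> q" for m p q
  proof -
    obtain a b where ab: "m = a + b" "a \<in> keys (e3 * X v - e4 :: 'k mpoly4)" "b \<in> keys ((e3 * X v - e4) ^ n :: 'k mpoly4)"
      using m keys_mult[of "e3 * X v - e4 :: 'k mpoly4" "(e3 * X v - e4) ^ n"] by auto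
    have "n \<le> lookup b p + lookup b q" using Suc.IH ab(3) \<open>p \<noteq> q\<close> unfolding monomial_ideal_def by blast
    with k[OF ab(2) \<open>p \<noteq> q\<close>] show ?thesis by (simp add: ab(1) lookup_add)
  qed
  then show ?case unfolding monomial_ideal_def by blast
qed

text \<open>Each variable is a root of the polynomial with coefficients \<open>\<plusminus>e\<^sub>i\<close>, and \<open>e3\<close>, \<open>e4\<close> are nilpotent modulo the ideal.
  So an element annihilated by \<open>e2\<close> modulo \<open>e1\<close> is annihilated by powers of all variables.\<close>

lemma ACM_if_cocycles_exact:
  fixes w :: "var \<Rightarrow> var \<Rightarrow> nat"
  assumes cob: "cocycles (monomial_ideal (meets w)) \<subseteq> coboundaries (monomial_ideal (meets w) :: 'k::field mpoly4 set)"
  shows "ACM (monomial_ideal (meets w) :: 'k mpoly4 set)"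
proof -
  let ?I = "monomial_ideal (meets w) :: 'k mpoly4 set" and ?J = "ideal_gen (insert e1 (monomial_ideal (meets w))) :: 'k mpoly4 set"
  define N where "N = Max (range (\<lambda>(p, q). w p q))"
  have N: "w p q \<le> N" for p q unfolding N_def by (intro Max_ge) auto
  have J: "is_ideal ?J" by (rule is_ideal_ideal_gen)
  have mu: "\<And>r x. x \<in> ?J \<Longrightarrow> r * x \<in> ?J" and ad: "\<And>x y. x \<in> ?J \<Longrightarrow> y \<in> ?J \<Longrightarrow> x + y \<in> ?J"
    using J unfolding is_ideal_def by blast+
  have IJ: "?I \<subseteq> ?J" and eJ: "e1 \<in> ?J" using ideal_gen_superset[of "insert e1 ?I"] by blast+
  have "z \<in> ?J" if z: "e2 * z \<in> ?J" for z
  proof (rule saturated_power[OF J, where N = "4 * N"])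
    show "y \<in> ?J" if "\<And>v. X v * y \<in> ?J" for y using socle_mod_e1[OF cob that] .
    fix v
    let ?E = "e3 * X v - e4 :: 'k mpoly4"
    \<comment> \<open>The terms with \<open>e1\<close> and \<open>e2\<close> send \<open>z\<close>
      into \<open>?J\<close>, so modulo \<open>?J\<close> the fourth power of each variable acts on
      \<open>z\<close> as \<open>?E\<close>.\<close>
    have "X v ^ 4 = ?E + X v ^ 3 * e1 - X v ^ 2 * e2"
      unfolding e1_expand e2_def e3_def e4_def by (rule quartic_root) (cases v; simp)
    then have st: "X v ^ 4 * z = ?E * z + (X v ^ 3 * z * e1 - X v ^ 2 * (e2 * z))" by algebra
    have j: "X v ^ 3 * z * e1 - X v ^ 2 * (e2 * z) \<in> ?J" using z eJ mu by (intro is_ideal_diff[OF J]) auto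
    have "\<exists>j\<in>?J. X v ^ (4 * n) * z = ?E ^ n * z + j" for n
    proof (induction n)
      case 0
      have "0 \<in> ?J" using J unfolding is_ideal_def by blast
      then show ?case by auto
    next
      case (Suc n)
      then obtain j' where j': "j' \<in> ?J" "X v ^ (4 * n) * z = ?E ^ n * z + j'" by blast
      have "X v ^ (4 * Suc n) * z = X v ^ 4 * (X v ^ (4 * n) * z)" by (simp add: power_add mult_ac)
      also have "\<dots> = ?E ^ n * (X v ^ 4 * z) + X v ^ 4 * j'" unfolding j'(2) by (simp add: distrib_left mult_ac)
      also have "\<dots> = ?E ^ Suc n * z + (?E ^ n * (X v ^ 3 * z * e1 - X v ^ 2 * (e2 * z)) + X v ^ 4 * j')"
        unfolding st by (simp only: distrib_left power_Suc mult_ac add.assoc)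
      finally show ?case using ad[OF mu[OF j] mu[OF j'(1)]] by blast
    qed
    then obtain j' where j': "j' \<in> ?J" "X v ^ (4 * N) * z = ?E ^ N * z + j'" by blast
    have "?E ^ N \<in> ?I"
      unfolding monomial_ideal_def meets_def
    proof (intro CollectI ballI allI impI)
      fix m p q assume "m \<in> keys (?E ^ N)" "p \<noteq> (q :: var)"
      then have "N \<le> lookup m p + lookup m q"
        using triple_products_power[of v N, where 'k='k] unfolding monomial_ideal_def by blast
      with N show "w p q \<le> lookup m p + lookup m q" by (rule order_trans)
    qed
    then have "z * ?E ^ N \<in> ?J" using IJ mu by blast
    then show "X v ^ (4 * N) * z \<in> ?J" unfolding j'(2) using ad j'(1) by (simp add: mult.commute)
  qed
  moreover have "homogeneous 1 (e1 :: 'k mpoly4)"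
    unfolding e1_expand by (intro homogeneous_add homogeneous_X)
  moreover have "homogeneous 2 (X u * X v :: 'k mpoly4)" for u v
    using homogeneous_mult[OF homogeneous_X homogeneous_X, of u v] by (simp only: one_add_one)
  then have "homogeneous 2 (e2 :: 'k mpoly4)"
    unfolding e2_def by (intro homogeneous_add)
  ultimately show ?thesis
    unfolding ACM_def using e1_regular[of _ w, where 'k='k]
    by (intro exI[of _ e1] exI[of _ e2] exI[of _ "1::nat"] exI[of _ "2::nat"]) auto
qed

lemma ext_dim_pos_if_not_ACM:
  assumes "\<not> ACM (monomial_ideal (meets w) :: 'k::field mpoly4 set)"
  shows "ext_dim_ge 1 (monomial_ideal (meets w) :: 'k mpoly4 set)"
proof -
  let ?I = "monomial_ideal (meets w) :: 'k mpoly4 set"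
  obtain u where u: "u \<in> cocycles ?I" "u \<notin> coboundaries ?I"
    using assms ACM_if_cocycles_exact by blast
  have "c = 0" if cb: "(\<lambda>v. single 0 c * u v) \<in> coboundaries ?I" for c
  proof (rule ccontr)
    assume c: "c \<noteq> 0"
    obtain r where r: "\<And>v. single 0 c * u v - X v * r \<in> ?I" using cb unfolding coboundaries_def by blast
    have inv: "single 0 (inverse c) * single 0 c = (1 :: 'k mpoly4)" using c by (simp add: mult_single)
    have "u v - X v * (single 0 (inverse c) * r) \<in> ?I" for v
    proof -
      have "u v - X v * (single 0 (inverse c) * r) = single 0 (inverse c) * (single 0 c * u v - X v * r)"
        using inv by algebra
      then show ?thesis using r is_ideal_meets[of w, where 'a='k] unfolding is_ideal_def by simp
    qed
    with u(2) show False unfolding coboundaries_def by blast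
  qed
  with u(1) show ?thesis unfolding ext_dim_ge_def by (intro exI[of _ "\<lambda>_. u"]) auto
qed

section \<open>Linear resolutions\<close>

definition comb :: "(nat \<Rightarrow> 'r::comm_ring_1) \<Rightarrow> nat \<Rightarrow> (nat \<Rightarrow> 'r) \<Rightarrow> 'r" where
  "comb g n x = (\<Sum>j<n. x j * g j)"

lemma comb_add: "comb g n (\<lambda>j. x j + y j) = comb g n x + comb g n y"
  by (simp add: comb_def distrib_right sum.distrib)

lemma comb_diff: "comb g n (\<lambda>j. x j - y j) = comb g n x - comb g n y"
  by (simp add: comb_def left_diff_distrib sum_subtractf)

lemma comb_uminus: "comb g n (\<lambda>j. - x j) = - comb g n x"
  by (simp add: comb_def sum_negf)

lemma comb_scale: "comb g n (\<lambda>j. r * x j) = r * comb g n x"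
  by (simp add: comb_def sum_distrib_left mult.assoc)

lemma keys_comb: "keys (comb g n x) \<subseteq> (\<Union>j<n. keys (x j * g j))" for g :: "nat \<Rightarrow> 'k::comm_ring_1 mpoly4"
  unfolding comb_def by (rule keys_sum_subset)

lemma mat_map_comb: "mat_map M r c w i = (if i < r then comb (M i) c w else 0)"
  by (simp add: mat_map_def comb_def mult.commute)

lemma mat_map_add: "mat_map M r c (\<lambda>j. x j + y j) i = mat_map M r c x i + mat_map M r c y i"
  by (simp add: mat_map_comb comb_add)

lemma mat_map_diff: "mat_map M r c (\<lambda>j. x j - y j) i = mat_map M r c x i - mat_map M r c y i"
  by (simp add: mat_map_comb comb_diff)

lemma mat_map_uminus: "mat_map M r c (\<lambda>j. - x j) i = - mat_map M r c x i"
  by (simp add: mat_map_comb comb_uminus)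

lemma mat_map_scale: "mat_map M r c (\<lambda>j. t * x j) i = t * mat_map M r c x i"
  by (simp add: mat_map_comb comb_scale)

lemmas mat_map_linear = mat_map_add mat_map_diff mat_map_uminus mat_map_scale
lemmas comb_linear = comb_add comb_diff comb_uminus comb_scale

lemma mat_map_truncate: "mat_map M r c w = mat_map M r c (\<lambda>j. if j < c then w j else 0)"
  by (rule ext) (simp add: mat_map_def)

definition order_ge :: "nat \<Rightarrow> 'k::comm_ring_1 mpoly4 \<Rightarrow> bool" where
  "order_ge k F \<longleftrightarrow> (\<forall>m\<in>keys F. k \<le> mon_deg m)"

lemma order_ge_add: "order_ge k F \<Longrightarrow> order_ge k G \<Longrightarrow> order_ge k (F + G)"
  unfolding order_ge_def using Poly_Mapping.keys_add[of F G] by blast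

lemma order_ge_uminus: "order_ge k F \<Longrightarrow> order_ge k (- F)"
  unfolding order_ge_def by (simp add: in_keys_iff)

lemma order_ge_diff: "order_ge k F \<Longrightarrow> order_ge k G \<Longrightarrow> order_ge k (F - G)"
  using order_ge_add[of k F "- G"] order_ge_uminus[of k G] by simp

lemma order_ge_X_mult: "order_ge k F \<Longrightarrow> order_ge (Suc k) (X v * F)"
  unfolding order_ge_def by (auto simp: keys_X_mult mon_deg_add mon_deg_ev)

lemma mon_deg_eq_0: "mon_deg m = 0 \<longleftrightarrow> m = 0"
  by (auto simp: mon_deg_sum intro: poly_mapping_eqI)

definition drop_const :: "'k::comm_ring_1 mpoly4 \<Rightarrow> 'k mpoly4" where
  "drop_const F = F - single 0 (lookup F 0)"

lemma order_ge_drop_const: "order_ge 1 (drop_const F)"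
proof -
  have "m \<noteq> 0" if "m \<in> keys (drop_const F)" for m
    using that by (auto simp: drop_const_def in_keys_iff lookup_minus)
  then show ?thesis unfolding order_ge_def using mon_deg_eq_0 by (metis less_one not_le)
qed

text \<open>The part of degree \<open>h\<close> of \<open>comb g n x\<close> only involves the constant terms of the \<open>x j\<close>.\<close>

lemma comb_drop_const:
  fixes g :: "nat \<Rightarrow> 'k::comm_ring_1 mpoly4"
  assumes g: "\<And>j. j < n \<Longrightarrow> homogeneous h (g j)"
    and x: "\<And>m. m \<in> keys (comb g n x) \<Longrightarrow> mon_deg m \<noteq> h"
  shows "comb g n (\<lambda>j. drop_const (x j)) = comb g n x"
proof -
  define A where "A = comb g n (\<lambda>j. single 0 (lookup (x j) 0))"
  define B where "B = comb g n (\<lambda>j. drop_const (x j))"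
  have AB: "comb g n x = A + B"
    unfolding A_def B_def comb_add[symmetric] by (simp add: drop_const_def)
  have A: "mon_deg m = h" if m: "m \<in> keys A" for m
  proof -
    obtain j where j: "j < n" "m \<in> keys (single 0 (lookup (x j) 0) * g j)"
      using subsetD[OF keys_comb m[unfolded A_def]] by auto
    then have "m \<in> keys (g j)" by (auto simp: in_keys_iff lookup_const_mult)
    with g j show ?thesis unfolding homogeneous_def by blast
  qed
  have B: "mon_deg m > h" if m: "m \<in> keys B" for m
  proof -
    obtain j where j: "j < n" "m \<in> keys (drop_const (x j) * g j)"
      using subsetD[OF keys_comb m[unfolded B_def]] by auto
    then obtain a b where "m = a + b" "a \<in> keys (drop_const (x j))" "b \<in> keys (g j)"
      using keys_mult by blast
    with g j order_ge_drop_const[of "x j"] show ?thesis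
      unfolding homogeneous_def order_ge_def by (auto simp: mon_deg_add Suc_le_eq)
  qed
  have "A = 0"
  proof (rule ccontr)
    assume "A \<noteq> 0"
    then obtain m where m: "m \<in> keys A" by (metis keys_eq_empty ex_in_conv)
    then have "m \<notin> keys B" using A B by fastforce
    with m have "m \<in> keys (comb g n x)" unfolding AB by (simp add: in_keys_iff lookup_add)
    with x A m show False by blast
  qed
  then show ?thesis using AB B_def by simp
qed

text \<open>The initial segment of a linear resolution, padded with zero modules if the resolution is shorter.\<close>

locale linear_presentation =
  fixes I :: "'k::field mpoly4 set" and d b0 b1 b2 :: nat and g :: "nat \<Rightarrow> 'k mpoly4"
    and M1 M2 :: "nat \<Rightarrow> nat \<Rightarrow> 'k mpoly4"
  assumes hom_g: "j < b0 \<Longrightarrow> homogeneous d (g j)"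
    and I_eq: "I = {comb g b0 v | v. True}"
    and hom1: "homogeneous 1 (M1 r c)" and hom2: "homogeneous 1 (M2 r c)"
    and exact0: "in_free b0 v \<Longrightarrow> comb g b0 v = 0 \<Longrightarrow> \<exists>w. v = mat_map M1 b0 b1 w"
    and complex0: "comb g b0 (mat_map M1 b0 b1 w) = 0"
    and exact1: "in_free b1 v \<Longrightarrow> mat_map M1 b0 b1 v = (\<lambda>_. 0) \<Longrightarrow> \<exists>w. v = mat_map M2 b1 b2 w"
    and complex1: "mat_map M1 b0 b1 (mat_map M2 b1 b2 w) = (\<lambda>_. 0)"

lemma linear_resolution_presentation:
  fixes I :: "'k::field mpoly4 set"
  assumes "linear_resolution I"
  shows "\<exists>d b0 b1 b2 g M1 M2. linear_presentation I d b0 b1 b2 g M1 M2"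
proof -
  obtain d n :: nat and b :: "nat \<Rightarrow> nat" and g :: "nat \<Rightarrow> 'k mpoly4"
    and M :: "nat \<Rightarrow> nat \<Rightarrow> nat \<Rightarrow> 'k mpoly4" where hg: "\<forall>j<b 0. homogeneous d (g j)"
    and I: "I = {(\<Sum>j<b 0. v j * g j) | v. True}"
    and hM: "\<forall>i\<in>{1..n}. \<forall>r c. homogeneous 1 (M i r c)"
    and e0: "{v. in_free (b 0) v \<and> (\<Sum>j<b 0. v j * g j) = 0} =
         (if n = 0 then {(\<lambda>_. 0)} else mat_map (M 1) (b 0) (b 1) ` {w. in_free (b 1) w})"
    and ei: "\<forall>i\<in>{1..n}. {v. in_free (b i) v \<and> mat_map (M i) (b (i - 1)) (b i) v = (\<lambda>_. 0)} =
         (if i = n then {(\<lambda>_. 0)}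
          else mat_map (M (i + 1)) (b i) (b (i + 1)) ` {w. in_free (b (i + 1)) w})"
    using assms unfolding linear_resolution_def
    apply (elim exE conjE)
    subgoal for d n b g M by (rule that[of b d g n M])
    done
  define b' where "b' i = (if i \<le> n then b i else 0)" for i
  define M' where "M' i r c = (if 1 \<le> i \<and> i \<le> n then M i r c else 0)" for i r c
  have hom: "homogeneous 1 (M' i r c)" for i r c
    using hM unfolding M'_def by (auto simp: homogeneous_def)
  \<comment> \<open>Truncating \<open>w\<close> at \<open>c\<close> leaves its image unchanged, so
    images may be taken over all families.\<close>
  have img: "mat_map N r c ` {w. in_free c w} = range (mat_map N r c)" for N :: "nat \<Rightarrow> nat \<Rightarrow> 'k mpoly4" and r c
  proof
    show "range (mat_map N r c) \<subseteq> mat_map N r c ` {w. in_free c w}"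
    proof
      fix v assume "v \<in> range (mat_map N r c)"
      then obtain w where "v = mat_map N r c w" by blast
      then have "v = mat_map N r c (\<lambda>j. if j < c then w j else 0)" by (simp flip: mat_map_truncate)
      then show "v \<in> mat_map N r c ` {w. in_free c w}" by (auto simp: in_free_def)
    qed
  qed blast
  have zero: "range (mat_map N r 0) = {(\<lambda>_. 0)}" for N :: "nat \<Rightarrow> nat \<Rightarrow> 'k mpoly4" and r
  proof -
    have "mat_map N r 0 = (\<lambda>_ _. 0)" by (simp add: mat_map_def fun_eq_iff)
    then show ?thesis by simp
  qed
  have f0: "{v. in_free (b' 0) v \<and> comb g (b' 0) v = 0} = range (mat_map (M' 1) (b' 0) (b' 1))"
  proof (cases "n = 0")
    case True
    then show ?thesis using e0 by (simp add: b'_def comb_def zero)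
  next
    case False
    then have "M' 1 = M 1" by (auto simp: M'_def fun_eq_iff)
    with False show ?thesis using e0 by (simp add: b'_def comb_def img)
  qed
  have f1: "{v. in_free (b' 1) v \<and> mat_map (M' 1) (b' 0) (b' 1) v = (\<lambda>_. 0)} = range (mat_map (M' 2) (b' 1) (b' 2))"
  proof -
    consider "n = 0" | "n = 1" | "n \<ge> 2" by linarith
    then show ?thesis
    proof cases
      case 1
      then show ?thesis by (auto simp: b'_def in_free_def mat_map_def fun_eq_iff)
    next
      case 2
      then have "M' 1 = M 1" by (auto simp: M'_def fun_eq_iff)
      with 2 bspec[OF ei, of 1] show ?thesis by (simp add: b'_def zero)
    next
      case 3
      then have "M' 1 = M 1" "M' 2 = M 2" by (auto simp: M'_def fun_eq_iff)
      with 3 bspec[OF ei, of 1] show ?thesis by (simp add: b'_def img numeral_2_eq_2)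
    qed
  qed
  have "linear_presentation I d (b' 0) (b' 1) (b' 2) g (M' 1) (M' 2)"
  proof
    show "homogeneous d (g j)" if "j < b' 0" for j using hg that by (simp add: b'_def)
    show "I = {comb g (b' 0) v | v. True}" using I by (simp add: b'_def comb_def)
    show "comb g (b' 0) (mat_map (M' 1) (b' 0) (b' 1) w) = 0" for w using f0 by blast
    show "mat_map (M' 1) (b' 0) (b' 1) (mat_map (M' 2) (b' 1) (b' 2) w) = (\<lambda>_. 0)" for w using f1 by blast
  qed (use hom f0 f1 in blast)+
  then show ?thesis by blast
qed

section \<open>Generators and cocycles of an ideal with a linear presentation\<close>

context linear_presentation
begin

lemma generated_degree:
  assumes "F \<in> I" "m \<in> keys F"
  shows "\<exists>m' n. m = n + m' \<and> mon_deg m' = d \<and> (\<exists>G\<in>I. m' \<in> keys G)"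
proof -
  obtain v where F: "F = comb g b0 v" using assms(1) unfolding I_eq by blast
  obtain j where j: "j < b0" "m \<in> keys (v j * g j)"
    using subsetD[OF keys_comb assms(2)[unfolded F]] by auto
  then obtain n m' where *: "m = n + m'" "m' \<in> keys (g j)" using keys_mult by blast
  have "g j = comb g b0 (\<lambda>i. if i = j then 1 else 0)"
    unfolding comb_def using j by (subst sum.remove[of _ j]) auto
  then have "g j \<in> I" unfolding I_eq by blast
  with * hom_g[OF j(1)] show ?thesis unfolding homogeneous_def by blast
qed

text \<open>Through a matrix of linear forms the constants of \<open>w\<close> contribute exactly
  the part of degree 1, which is absent from the image.\<close>

lemma mat_map_drop_const:
  assumes N: "\<And>r c. homogeneous 1 (N r c)" and "\<And>i. order_ge 2 (mat_map N r c w i)"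
  shows "mat_map N r c (\<lambda>j. drop_const (w j)) = mat_map N r c w"
proof
  fix i
  have "comb (N i) c (\<lambda>j. drop_const (w j)) = comb (N i) c w" if i: "i < r"
  proof (rule comb_drop_const[OF N])
    fix m assume "m \<in> keys (comb (N i) c w)"
    then show "mon_deg m \<noteq> 1"
      using assms(2)[of i] i unfolding order_ge_def mat_map_comb by auto
  qed
  then show "mat_map N r c (\<lambda>j. drop_const (w j)) i = mat_map N r c w i" by (simp add: mat_map_comb)
qed

text \<open>The class of \<open>u\<close> is chased through the resolution and ends in Ext^4(k, F)
  for the third module F, that is, in vectors of constants. Without terms of degree
  \<open>d\<close>, every lift can be chosen free of constants, so this obstruction vanishes and
  Koszul exactness is unwound back to \<open>u\<close>.\<close>

lemma cocycle_exact_off_degree: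
  assumes u: "u \<in> cocycles I"
    and deg: "\<And>v t m. m \<in> keys (X v * u t - X t * u v) \<Longrightarrow> mon_deg m \<noteq> d"
  shows "u \<in> coboundaries I"
proof -
  let ?A = "X Va :: 'k mpoly4" and ?B = "X Vb :: 'k mpoly4" and ?C = "X Vc :: 'k mpoly4" and ?D = "X Vd :: 'k mpoly4"
  let ?P = "mat_map M1 b0 b1" and ?Q = "mat_map M2 b1 b2"
  have "\<exists>p. X v * u t - X t * u v = comb g b0 p \<and> in_free b0 p \<and> (\<forall>j. order_ge 1 (p j))" for v t
  proof -
    obtain p where p: "X v * u t - X t * u v = comb g b0 p"
      using u unfolding cocycles_def I_eq by blast
    have "comb g b0 (\<lambda>j. drop_const (p j)) = comb g b0 p"
      using deg[of _ v t] p by (intro comb_drop_const[of _ d] hom_g) auto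
    moreover have "comb g b0 (\<lambda>j. if j < b0 then drop_const (p j) else 0) = comb g b0 (\<lambda>j. drop_const (p j))"
      unfolding comb_def by (intro sum.cong) auto
    moreover have "order_ge 1 (if j < b0 then drop_const (p j) else 0)" for j
      using order_ge_drop_const[of "p j"] by (auto simp: order_ge_def)
    ultimately show ?thesis using p
      by (intro exI[of _ "\<lambda>j. if j < b0 then drop_const (p j) else 0"]) (auto simp: in_free_def)
  qed
  then obtain p where p: "\<And>v t. X v * u t - X t * u v = comb g b0 (p v t)"
    and p_free: "\<And>v t j. j \<ge> b0 \<Longrightarrow> p v t j = 0" and p_ord: "\<And>v t j. order_ge 1 (p v t j)"
    unfolding in_free_def by metis
  \<comment> \<open>The Koszul differential of \<open>p\<close>. It is a syzygy of the generators
    because \<open>p\<close> lifts the differential of \<open>u\<close>.\<close>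
  define T where "T s v t j = X s * p v t j - X v * p s t j + X t * p s v j" for s v t j
  have "\<exists>q. T s v t = ?P q \<and> in_free b1 q \<and> (\<forall>j. order_ge 1 (q j))" for s v t
  proof -
    have "comb g b0 (T s v t) = X s * comb g b0 (p v t) - X v * comb g b0 (p s t) + X t * comb g b0 (p s v)"
      unfolding T_def by (simp only: comb_linear)
    also have "\<dots> = 0" unfolding p[symmetric] by algebra
    finally have "comb g b0 (T s v t) = 0" .
    moreover have "in_free b0 (T s v t)" using p_free by (simp add: in_free_def T_def)
    ultimately obtain q where q: "T s v t = ?P q" using exact0 by blast
    have "order_ge 2 (T s v t i)" for i
      unfolding T_def numeral_2_eq_2
      using order_ge_X_mult[OF p_ord] by (intro order_ge_add order_ge_diff) (simp_all only: One_nat_def)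
    then have "?P (\<lambda>j. drop_const (q j)) = ?P q" unfolding q by (intro mat_map_drop_const hom1)
    moreover have "?P (\<lambda>j. if j < b1 then drop_const (q j) else 0) = ?P (\<lambda>j. drop_const (q j))"
      by (simp flip: mat_map_truncate)
    moreover have "order_ge 1 (if j < b1 then drop_const (q j) else 0)" for j
      using order_ge_drop_const[of "q j"] by (auto simp: order_ge_def)
    ultimately show ?thesis using q
      by (intro exI[of _ "\<lambda>j. if j < b1 then drop_const (q j) else 0"]) (auto simp: in_free_def)
  qed
  then obtain q where q: "\<And>s v t. ?P (q s v t) = T s v t"
    and q_free: "\<And>s v t j. j \<ge> b1 \<Longrightarrow> q s v t j = 0" and q_ord: "\<And>s v t j. order_ge 1 (q s v t j)"
    unfolding in_free_def by metis
  \<comment> \<open>The Koszul differential of \<open>q\<close>; \<open>?P\<close> maps it to the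
    differential of \<open>T\<close>, which is zero.\<close>
  define L where "L j = ?A * q Vb Vc Vd j - ?B * q Va Vc Vd j + ?C * q Va Vb Vd j - ?D * q Va Vb Vc j" for j
  have "?P L i = 0" for i
  proof -
    have "?P L i = ?A * T Vb Vc Vd i - ?B * T Va Vc Vd i + ?C * T Va Vb Vd i - ?D * T Va Vb Vc i"
      unfolding L_def q[symmetric] by (simp only: mat_map_linear)
    then show ?thesis unfolding T_def by algebra
  qed
  moreover have "in_free b1 L" using q_free by (simp add: in_free_def L_def)
  ultimately obtain r0 where r0: "L = ?Q r0" using exact1 by blast
  have "order_ge 2 (L i)" for i
    unfolding L_def numeral_2_eq_2
    using order_ge_X_mult[OF q_ord] by (intro order_ge_add order_ge_diff) (simp_all only: One_nat_def)
  then have L: "L = ?Q (\<lambda>j. drop_const (r0 j))" unfolding r0 by (intro mat_map_drop_const[symmetric] hom2)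
  \<comment> \<open>A polynomial without constant term lies in the ideal of the variables.\<close>
  have "\<exists>ra rb rc rd. drop_const (r0 j) = ?A * ra + ?B * rb + ?C * rc + ?D * rd" for j
  proof -
    have "\<exists>v\<in>UNIV. lookup m v \<noteq> 0" if "m \<in> keys (drop_const (r0 j))" for m
      using order_ge_drop_const[of "r0 j"] that mon_deg_eq_0[of m] unfolding order_ge_def
      by (metis UNIV_I lookup_zero not_one_le_zero poly_mapping_eqI)
    then obtain \<rho> where "drop_const (r0 j) = (\<Sum>v\<in>UNIV. X v * \<rho> v)" using var_ideal_iff by blast
    then have "drop_const (r0 j) = ?A * \<rho> Va + ?B * \<rho> Vb + ?C * \<rho> Vc + ?D * \<rho> Vd"
      by (simp add: UNIV_var add.assoc)
    then show ?thesis by blast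
  qed
  then obtain ra rb rc rd where r: "\<And>j. drop_const (r0 j) = ?A * ra j + ?B * rb j + ?C * rc j + ?D * rd j" by metis
  have LQ: "L j = ?A * ?Q ra j + ?B * ?Q rb j + ?C * ?Q rc j + ?D * ?Q rd j" for j
    unfolding L r by (simp only: mat_map_linear)
  \<comment> \<open>Corrected by elements in the image of \<open>?Q\<close>, the entries of
    \<open>q\<close> have zero differential, and the correction is killed by
    \<open>?P\<close>.\<close>
  have "?A * (q Vb Vc Vd j - ?Q ra j) + ?B * (- q Va Vc Vd j - ?Q rb j)
      + ?C * (q Va Vb Vd j - ?Q rc j) + ?D * (- q Va Vb Vc j - ?Q rd j) = 0" for j
    using LQ[of j] L_def[of j] by algebra
  note ex3 = vars.exact3[OF this]
  obtain ab ac ad bc bd cd where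
    k: "\<And>j. q Vb Vc Vd j - ?Q ra j = ?B * cd j - ?C * bd j + ?D * bc j"
       "\<And>j. - q Va Vc Vd j - ?Q rb j = - (?A * cd j - ?C * ad j + ?D * ac j)"
       "\<And>j. q Va Vb Vd j - ?Q rc j = ?A * bd j - ?B * ad j + ?D * ab j"
       "\<And>j. - q Va Vb Vc j - ?Q rd j = - (?A * bc j - ?B * ac j + ?C * ab j)"
    using ex3 by metis
  have PQ: "?P (?Q w) i = 0" for w i using complex1[of w] by (simp add: fun_eq_iff)
  have T1: "T Va Vb Vc i = ?A * ?P bc i - ?B * ?P ac i + ?C * ?P ab i" for i
  proof -
    have "T Va Vb Vc i = - ?P (\<lambda>j. - q Va Vb Vc j - ?Q rd j) i" by (simp add: mat_map_linear PQ q)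
    then show ?thesis unfolding k by (simp add: mat_map_linear)
  qed
  have T2: "T Va Vb Vd i = ?A * ?P bd i - ?B * ?P ad i + ?D * ?P ab i" for i
  proof -
    have "T Va Vb Vd i = ?P (\<lambda>j. q Va Vb Vd j - ?Q rc j) i" by (simp add: mat_map_linear PQ q)
    then show ?thesis unfolding k by (simp add: mat_map_linear)
  qed
  have T3: "T Va Vc Vd i = ?A * ?P cd i - ?C * ?P ad i + ?D * ?P ac i" for i
  proof -
    have "T Va Vc Vd i = - ?P (\<lambda>j. - q Va Vc Vd j - ?Q rb j) i" by (simp add: mat_map_linear PQ q)
    then show ?thesis unfolding k by (simp add: mat_map_linear)
  qed
  have c1: "?A * (p Vb Vc i - ?P bc i) - ?B * (p Va Vc i - ?P ac i) + ?C * (p Va Vb i - ?P ab i) = 0" for i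
    using T1[of i] T_def[of Va Vb Vc i] by algebra
  have c2: "?A * (p Vb Vd i - ?P bd i) - ?B * (p Va Vd i - ?P ad i) + ?D * (p Va Vb i - ?P ab i) = 0" for i
    using T2[of i] T_def[of Va Vb Vd i] by algebra
  have c3: "?A * (p Vc Vd i - ?P cd i) - ?C * (p Va Vd i - ?P ad i) + ?D * (p Va Vc i - ?P ac i) = 0" for i
    using T3[of i] T_def[of Va Vc Vd i] by algebra
  have "\<exists>ya yb yc yd. p Va Vb i - ?P ab i = ?A * yb - ?B * ya \<and> p Va Vc i - ?P ac i = ?A * yc - ?C * ya
      \<and> p Va Vd i - ?P ad i = ?A * yd - ?D * ya" for i
    using vars.exact2[OF c1 c2 c3, of i] by blast
  then obtain ya yb yc yd where y: "\<And>i. p Va Vb i - ?P ab i = ?A * yb i - ?B * ya i"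
    "\<And>i. p Va Vc i - ?P ac i = ?A * yc i - ?C * ya i" "\<And>i. p Va Vd i - ?P ad i = ?A * yd i - ?D * ya i" by metis
  let ?g = "comb g b0"
  \<comment> \<open>The generators kill the image of \<open>?P\<close>, so the correction of
    \<open>p\<close> that makes it a Koszul coboundary does not change the differential of
    \<open>u\<close>.\<close>
  have W: "?g (p v t) = ?g (\<lambda>i. p v t i - ?P x i)" for v t x by (simp add: comb_linear complex0)
  have "?A * u Vb - ?B * u Va = ?A * ?g yb - ?B * ?g ya"
    unfolding p W[of Va Vb ab] y by (simp only: comb_linear)
  moreover have "?A * u Vc - ?C * u Va = ?A * ?g yc - ?C * ?g ya"
    unfolding p W[of Va Vc ac] y by (simp only: comb_linear)
  moreover have "?A * u Vd - ?D * u Va = ?A * ?g yd - ?D * ?g ya"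
    unfolding p W[of Va Vd ad] y by (simp only: comb_linear)
  ultimately have "?A * (u Vb - ?g yb) = ?B * (u Va - ?g ya)" "?A * (u Vc - ?g yc) = ?C * (u Va - ?g ya)"
    "?A * (u Vd - ?g yd) = ?D * (u Va - ?g ya)" by algebra+
  from vars.exact1[OF this] obtain r where "u Va - ?g ya = ?A * r" "u Vb - ?g yb = ?B * r"
    "u Vc - ?g yc = ?C * r" "u Vd - ?g yd = ?D * r" by blast
  then have "u Va - ?A * r = ?g ya" "u Vb - ?B * r = ?g yb" "u Vc - ?C * r = ?g yc" "u Vd - ?D * r = ?g yd"
    by algebra+
  then have "\<forall>v. u v - X v * r \<in> I" unfolding all_var I_eq by blast
  then show ?thesis unfolding coboundaries_def by blast
qed

end

section \<open>Tetrahedral curves with a linear resolution\<close>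

lemma critical_cocycle_not_coboundary:
  assumes m: "critical w p q r s m"
  shows "(critical_cocycle p q m :: var \<Rightarrow> 'k::comm_ring_1 mpoly4) \<notin> coboundaries (monomial_ideal (meets w))"
proof
  assume "(critical_cocycle p q m :: var \<Rightarrow> 'k mpoly4) \<in> coboundaries (monomial_ideal (meets w))"
  then obtain \<rho> where \<rho>: "\<And>v. critical_cocycle p q m v - X v * \<rho> \<in> (monomial_ideal (meets w) :: 'k mpoly4 set)"
    unfolding coboundaries_def by blast
  have d: "p \<noteq> q" "r \<noteq> s" "r \<noteq> p" "r \<noteq> q" "s \<noteq> p" "s \<noteq> q" using m by (auto simp: critical_def)
  have "\<not> meets w (m + ev p)"
    using m d by (intro not_meetsI[of r s]) (auto simp: lookup_add lookup_ev critical_def)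
  moreover have "\<not> meets w (m + ev r)"
    using m d by (intro not_meetsI[of p q]) (auto simp: lookup_add lookup_ev critical_def)
  ultimately have "m + ev p \<notin> keys (critical_cocycle p q m p - X p * \<rho>)" "m + ev r \<notin> keys (critical_cocycle p q m r - X r * \<rho>)"
    using \<rho> unfolding monomial_ideal_def by blast+
  then have "lookup \<rho> m = 1" "lookup \<rho> m = 0"
    using d by (simp_all add: in_keys_iff lookup_minus critical_cocycle_def)
  then show False by simp
qed

lemma mon_deg_distinct4:
  assumes "distinct [p, q, r, s]"
  shows "mon_deg m = lookup m p + lookup m q + lookup m r + lookup m s"
proof -
  have U: "UNIV = {p, q, r, s}" using var_distinct4[OF assms] by blast
  show ?thesis unfolding mon_deg_sum U using assms by simp
qed

context linear_presentation
begin

text \<open>The class of the critical cocycle is nonzero, so degree \<open>d\<close> occurs among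
  its Koszul products. These all have degree \<open>mon_deg m + 2\<close>, and each opposite line is
  missed by one.\<close>

lemma degree_eq_weights:
  assumes I: "I = monomial_ideal (meets w)" and sym: "\<And>p q. w p q = w q p"
    and m: "max_critical w p q r s m"
  shows "d = w p q + w r s"
proof -
  let ?u = "critical_cocycle p q m :: var \<Rightarrow> 'k mpoly4"
  have "?u \<in> cocycles I" unfolding I by (rule critical_cocycle_in[OF sym m])
  moreover have "?u \<notin> coboundaries I"
    unfolding I using m by (intro critical_cocycle_not_coboundary[of w p q r s]) (simp add: max_critical_def)
  ultimately obtain v t n where n: "n \<in> keys (X v * ?u t - X t * ?u v)" "mon_deg n = d"
    using cocycle_exact_off_degree by blast
  have "n \<in> keys (X v * ?u t) \<union> keys (X t * ?u v)" using n(1) by (auto simp: in_keys_iff lookup_minus)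
  then have "mon_deg n = mon_deg m + 2"
    by (auto simp: keys_X_mult critical_cocycle_def mon_deg_add mon_deg_ev split: if_splits)
  moreover have "mon_deg m = lookup m p + lookup m q + lookup m r + lookup m s"
    using m by (intro mon_deg_distinct4) (simp add: max_critical_def critical_def)
  ultimately show ?thesis using n(2) m unfolding max_critical_def by simp
qed

text \<open>A monomial of the ideal free of \<open>p\<close> has a divisor of degree
  \<open>d\<close> in the ideal. That divisor is free of \<open>p\<close> too, so its other entries
  are at least \<open>w p q\<close>, \<open>w p r\<close> and \<open>w p s\<close>, and their sum is
  \<open>w p q + w r s\<close>.\<close>

lemma weight_ineq:
  assumes I: "I = monomial_ideal (meets w)" and sym: "\<And>p q. w p q = w q p"
    and dist: "distinct [p, q, r, s]" and d: "d = w p q + w r s"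
  shows "w p r + w p s \<le> w r s"
proof -
  define N where "N = Max (range (\<lambda>(p, q). w p q))"
  have N: "w x y \<le> N" for x y unfolding N_def by (intro Max_ge) auto
  \<comment> \<open>\<open>N\<close> exceeds no requirement by accident: as an upper bound of all
    weights, it meets every line through \<open>q\<close> or \<open>s\<close>, and the entry
    \<open>w p r\<close> meets the line \<open>pr\<close>.\<close>
  define \<beta> where "\<beta> = single q N + single r (w p r) + single s N"
  have l: "lookup \<beta> p = 0" "lookup \<beta> q = N" "lookup \<beta> r = w p r" "lookup \<beta> s = N"
    using dist by (auto simp: \<beta>_def lookup_add lookup_single when_def)
  have "w x y \<le> lookup \<beta> x + lookup \<beta> y" if "x \<noteq> y" for x y
  proof -
    have "x \<in> {p, q, r, s}" "y \<in> {p, q, r, s}" using var_distinct4[OF dist] by blast+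
    then show ?thesis using that N[of x y] sym[of p r] by (auto simp: l)
  qed
  then have "single \<beta> 1 \<in> I" unfolding I monomial_ideal_def meets_def by simp
  then obtain m' n G where m': "\<beta> = n + m'" "mon_deg m' = d" "G \<in> I" "m' \<in> keys G"
    using generated_degree[of "single \<beta> 1" \<beta>] by auto
  then have "meets w m'" unfolding I monomial_ideal_def by blast
  then have ge: "w x y \<le> lookup m' x + lookup m' y" if "x \<noteq> y" for x y using that unfolding meets_def by blast
  have le: "lookup m' x \<le> lookup \<beta> x" for x unfolding m'(1) by (simp add: lookup_add)
  have "mon_deg m' = lookup m' p + lookup m' q + lookup m' r + lookup m' s" by (rule mon_deg_distinct4[OF dist])
  then show ?thesis
    using ge[of p q] ge[of p r] ge[of p s] ge[of r s] le[of p] le[of r] l m'(2) d dist by auto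
qed

end

lemma max_critical_swap:
  assumes sym: "\<And>p q. w p q = w q p" and "max_critical w p q r s m"
  shows "max_critical w r s p q m"
proof -
  have "distinct [r, s, p, q] = distinct [p, q, r, s]" by auto
  then show ?thesis
    using assms(2) sym[of r p] sym[of r q] sym[of s p] sym[of s q]
    unfolding max_critical_def critical_def by linarith
qed

text \<open>The dimension of the socle bounds the weights of two opposite lines carrying a socle
  element; the four inequalities bound the other weights by these two.\<close>

lemma linear_resolution_weights_bounded:
  fixes w :: "var \<Rightarrow> var \<Rightarrow> nat"
  assumes sym: "\<And>p q. w p q = w q p"
    and lin: "linear_resolution (monomial_ideal (meets w) :: 'k::field mpoly4 set)"
    and pos: "ext_dim_ge 1 (monomial_ideal (meets w) :: 'k mpoly4 set)"
    and bound: "\<And>n. ext_dim_ge n (monomial_ideal (meets w) :: 'k mpoly4 set) \<Longrightarrow> n \<le> N"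
    and xy: "x \<noteq> y"
  shows "w x y \<le> N + 2"
proof -
  obtain d b0 b1 b2 and g :: "nat \<Rightarrow> 'k mpoly4" and M1 M2
    where "linear_presentation (monomial_ideal (meets w)) d b0 b1 b2 g M1 M2"
    using linear_resolution_presentation[OF lin] by blast
  then interpret linear_presentation "monomial_ideal (meets w) :: 'k mpoly4 set" d b0 b1 b2 g M1 M2 .
  obtain p q r s m where m: "max_critical w p q r s m" using exists_critical[OF sym pos] by blast
  have dist: "distinct [p, q, r, s]" using m by (simp add: max_critical_def critical_def)
  have d: "d = w p q + w r s" by (rule degree_eq_weights[OF refl sym m])
  have i1: "w p r + w p s \<le> w r s" by (rule weight_ineq[OF refl sym dist d])
  have i2: "w q r + w q s \<le> w r s"
    using dist d sym[of p q] by (intro weight_ineq[OF refl sym]) auto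
  have i3: "w r p + w r q \<le> w p q"
    using dist d by (intro weight_ineq[OF refl sym]) auto
  have i4: "w s p + w s q \<le> w p q"
    using dist d sym[of r s] by (intro weight_ineq[OF refl sym]) auto
  have "w p q \<le> N + 2" using bound[OF ext_dim_ge_weight[OF sym m i1 i2]] by simp
  moreover have "w r s \<le> N + 2" using bound[OF ext_dim_ge_weight[OF sym max_critical_swap[OF sym m] i3 i4]] by simp
  moreover have "x \<in> {p, q, r, s}" "y \<in> {p, q, r, s}" using var_distinct4[OF dist] by blast+
  ultimately show ?thesis
    using xy i1 i2 i3 i4 sym[of p q] sym[of r s] sym[of p r] sym[of p s] sym[of q r] sym[of q s] by auto
qed

theorem theorem6p5:
  fixes a1 a2 a3 a4 a5 a6 :: nat
  assumes "\<not> ACM (tetrahedral a1 a2 a3 a4 a5 a6 :: 'k::field mpoly4 set)"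
  shows "finite {J :: 'k mpoly4 set.
            (\<exists>b1 b2 b3 b4 b5 b6. J = tetrahedral b1 b2 b3 b4 b5 b6) \<and>
            evenly_linked (tetrahedral a1 a2 a3 a4 a5 a6) J \<and>
            linear_resolution J}"
proof -
  let ?L = "{J :: 'k mpoly4 set. (\<exists>b1 b2 b3 b4 b5 b6. J = tetrahedral b1 b2 b3 b4 b5 b6) \<and>
    evenly_linked (tetrahedral a1 a2 a3 a4 a5 a6) J \<and> linear_resolution J}"
  let ?I = "tetrahedral a1 a2 a3 a4 a5 a6 :: 'k mpoly4 set"
  have pos: "ext_dim_ge 1 ?I" using assms unfolding tetrahedral_monomial by (rule ext_dim_pos_if_not_ACM)
  obtain N where N: "\<And>n. ext_dim_ge n ?I \<Longrightarrow> n \<le> N"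
    using ext_dim_bounded[of "edge_weight a1 a2 a3 a4 a5 a6", OF edge_weight_sym, where 'k='k] unfolding tetrahedral_monomial by blast
  let ?S = "{..N + 2}"
  \<comment> \<open>The number \<open>N\<close> depends only on the linkage class, so all six
    multiplicities range over one finite box.\<close>
  have "?L \<subseteq> (\<lambda>(b1, b2, b3, b4, b5, b6). tetrahedral b1 b2 b3 b4 b5 b6) ` (?S \<times> ?S \<times> ?S \<times> ?S \<times> ?S \<times> ?S)"
  proof
    fix J assume "J \<in> ?L"
    then obtain b1 b2 b3 b4 b5 b6 where J: "J = tetrahedral b1 b2 b3 b4 b5 b6"
      and ev: "evenly_linked ?I J" and lin: "linear_resolution J" by blast
    let ?w = "edge_weight b1 b2 b3 b4 b5 b6"
    have Jw: "J = monomial_ideal (meets ?w)" unfolding J by (rule tetrahedral_monomial)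
    note dim = ext_dim_ge_evenly_linked[OF ev]
    have "?w x y \<le> N + 2" if "x \<noteq> y" for x y
    proof (rule linear_resolution_weights_bounded[OF edge_weight_sym _ _ _ that])
      show "linear_resolution (monomial_ideal (meets ?w) :: 'k mpoly4 set)" using lin unfolding Jw .
      show "ext_dim_ge 1 (monomial_ideal (meets ?w) :: 'k mpoly4 set)" using pos dim unfolding Jw by blast
      show "n \<le> N" if "ext_dim_ge n (monomial_ideal (meets ?w) :: 'k mpoly4 set)" for n
        using that N dim unfolding Jw by blast
    qed
    from this[of Va Vb] this[of Va Vc] this[of Va Vd] this[of Vb Vc] this[of Vb Vd] this[of Vc Vd]
    have "(b1, b2, b3, b4, b5, b6) \<in> ?S \<times> ?S \<times> ?S \<times> ?S \<times> ?S \<times> ?S"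
      by (simp add: edge_weight_def doubleton_eq_iff)
    then show "J \<in> (\<lambda>(b1, b2, b3, b4, b5, b6). tetrahedral b1 b2 b3 b4 b5 b6) ` (?S \<times> ?S \<times> ?S \<times> ?S \<times> ?S \<times> ?S)"
      unfolding J by (rule rev_image_eqI) (simp only: prod.case)
  qed
  then show ?thesis
    by (rule finite_subset) (intro finite_imageI finite_cartesian_product finite_atMost)
qed

end
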